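(* For every $K\ge 1$ and $\delta>0$ there is a constant $N$, depending only on $K$ and $\delta$, such that the following holds. Let $\rho:[0,1]\to\mathbb{R}$ be measurable with $K^{-1}\le\rho(x)\le K$ for a.e. $x\in[0,1]$, let $\omega\subset(0,1)$ be an open set with inradius $\delta$, and let $e_1,e_2,\dots$ and $0<\lambda_1^2<\lambda_2^2<\cdots$ (with $\lambda_k>0$) be the eigenfunctions and eigenvalues of the Sturm-Liouville problem $e''+\rho(x)\lambda^2e=0$ in $(0,1)$, $e(0)=e(1)=0$, with the eigenfunctions normalized by $\int_0^1\rho\,e_k^2\,dx=1$. Then $$\sum_{\lambda_k\le\mu}a_k^2\le Ne^{N\mu}\int_{\omega}\Big|\sum_{\lambda_k\le\mu}a_ke_k\Big|^2\,dx$$ for all $\mu\ge 1$ and all sequences $\{a_k\}$ of real numbers.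
   Context: The inradius of an open set $\omega\subset(0,1)$ is $\delta=\sup\{r>0 : \exists\,\xi\in\omega \text{ with } (\xi-r,\xi+r)\subset\omega\}$. The eigenfunctions $e_k$ are real-valued, the equation $e_k''+\rho\lambda_k^2e_k=0$ holds a.e. in $(0,1)$, and all eigenvalues are simple. *)

theory Defs
  imports "HOL-Analysis.Analysis"
begin

(* Taken in ennreal so that the supremum over no radii (empty set) is 0;
   Sup {} is unspecified on type real. *)
definition inradius :: "real set \<Rightarrow> ennreal" where
  "inradius \<omega> = (SUP r\<in>{r. r > 0 \<and> (\<exists>\<xi>\<in>\<omega>. {\<xi> - r<..<\<xi> + r} \<subseteq> \<omega>)}. ennreal r)"

(* Absolute continuity of a function. HOL-Analysis only has the notion for measures.
   D ranges over the finite families of non-overlapping compact intervals contained in S. *)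
definition abs_continuous_on :: "real set \<Rightarrow> (real \<Rightarrow> real) \<Rightarrow> bool" where
  "abs_continuous_on S f \<longleftrightarrow>
    (\<forall>\<epsilon>>0. \<exists>\<eta>>0. \<forall>D. D division_of \<Union>D \<and> \<Union>D \<subseteq> S \<and> (\<Sum>k\<in>D. Sup k - Inf k) < \<eta> \<longrightarrow>
      (\<Sum>k\<in>D. \<bar>f (Sup k) - f (Inf k)\<bar>) < \<epsilon>)"

(* u'' + \<Lambda> \<rho> u = 0 a.e. in (0,1), in the Caratheodory sense: u is C^1 on [0,1] with absolutely
   continuous derivative v. Without absolute continuity the a.e. equation would be far too weak. *)
definition sturm_liouville_solution :: "(real \<Rightarrow> real) \<Rightarrow> real \<Rightarrow> (real \<Rightarrow> real) \<Rightarrow> bool" where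
  "sturm_liouville_solution \<rho> \<Lambda> u \<longleftrightarrow>
    (\<exists>v. (\<forall>x\<in>{0..1}. (u has_real_derivative v x) (at x within {0..1})) \<and>
         abs_continuous_on {0..1} v \<and>
         (AE x in lebesgue_on {0<..<1}. \<exists>w. (v has_real_derivative w) (at x) \<and> w + \<rho> x * \<Lambda> * u x = 0))"

definition dirichlet_eigenfunction :: "(real \<Rightarrow> real) \<Rightarrow> real \<Rightarrow> (real \<Rightarrow> real) \<Rightarrow> bool" where
  "dirichlet_eigenfunction \<rho> \<Lambda> u \<longleftrightarrow>
    sturm_liouville_solution \<rho> \<Lambda> u \<and> u 0 = 0 \<and> u 1 = 0 \<and> (\<exists>x\<in>{0..1}. u x \<noteq> 0)"

definition dirichlet_eigenvalue :: "(real \<Rightarrow> real) \<Rightarrow> real \<Rightarrow> bool" where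
  "dirichlet_eigenvalue \<rho> \<Lambda> \<longleftrightarrow> (\<exists>u. dirichlet_eigenfunction \<rho> \<Lambda> u)"

(* Sequences are indexed from 1, the values at index 0 are irrelevant. The squares of the l k list
   all eigenvalues. *)
definition normalized_eigensystem ::
  "(real \<Rightarrow> real) \<Rightarrow> (nat \<Rightarrow> real) \<Rightarrow> (nat \<Rightarrow> real \<Rightarrow> real) \<Rightarrow> bool" where
  "normalized_eigensystem \<rho> l e \<longleftrightarrow>
    (\<forall>k\<ge>1. l k > 0) \<and>
    strict_mono_on {1..} (\<lambda>k. (l k)\<^sup>2) \<and>
    (\<lambda>k. (l k)\<^sup>2) ` {1..} = {\<Lambda>. dirichlet_eigenvalue \<rho> \<Lambda>} \<and>
    (\<forall>k\<ge>1. dirichlet_eigenfunction \<rho> ((l k)\<^sup>2) (e k) \<and>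
           (LINT x|lebesgue_on {0..1}. \<rho> x * (e k x)\<^sup>2) = 1)"

end

(* The mechanism is a Bernstein-Remez argument adapted to the operator u \<mapsto> -u''/\<rho>. For
   f = \<Sum> a_k e_k put f_j = \<Sum> a_k l_k^(2j) e_k, so that f_j'' = -\<rho> f_(j+1), and f_j is at most
   \<mu>^(2j+1) |a| on [0,1]: f behaves like an entire function of exponential type \<mu>. On an interval I
   inside \<omega> compare f with a multiple T of a solution of S'' = -L^2 \<rho> S, where L is a large multiple
   of \<mu>. T makes more than 2n+1 oscillations in I, and the Pruefer amplitude shows that it exceeds |f|
   on a part of every nodal interval as soon as its size is e^(CL) times the L2 norm of f on I. Hence
   f - T has 2n+1 zeros in I. Rolle's theorem produces interlacing zeros of (f - T)', f_1 - T_1, ...;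
   integrating back from monotone nodes gives the factorial in the bound
     |f - T| \<le> K^n sup|f_n - T_n| / (2n)!
   on one side of I, and a reflection gives it on the other. With n a multiple of K \<mu> the
   contribution of f_n is at most |a|/(2K), which is absorbed by |a| \<le> K sup|f|. *)
theory Submission
  imports Defs
begin

section \<open>Lipschitz primitives and the fundamental theorem of calculus\<close>

text \<open>Since \<rho> is only bounded and measurable, f has in general no derivatives beyond the
  second, so neither Taylor expansion nor analytic continuation of f itself is available; every step
  may use only 1/K \<le> \<rho> \<le> K. This is why T is not a polynomial or a plain sine: f - T
  has to satisfy the same chain of equations as f, so T must solve an equation with the same \<rho>,
  and then T_j = L^(2j) T. The term that this adds to the remainder has the factor K^n L^(2n) /
  (2n)! \<le> e^(LK), so L may be as large as the count of oscillations demands. The constants are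
  forced in this order. Absorption asks for 2K\<mu> (K\<mu>)^(2n) \<le> (2n)!, hence n about
  5K\<mu>. Placing 2n+2 half-waves in an interval of length h asks for L h \<ge> K (2n+3) \<pi>,
  hence L of order K^2 \<mu> / h, and all losses are of the form e^(C\<mu>). A second difficulty is
  that u'' exists only almost everywhere. The calculus is therefore done with Lipschitz functions
  differentiable off a null set, with a fundamental theorem and a substitute for Rolle's theorem for
  u'.\<close>

lemma abs_continuous_on_subset:
  assumes "abs_continuous_on T F" "S \<subseteq> T"
  shows "abs_continuous_on S F"
  using assms unfolding abs_continuous_on_def by (meson order_trans)

text \<open>A Henstock-Kurzweil argument: the gauge treats tags outside \<open>Z\<close> by
  differentiability and tags in \<open>Z\<close> by absolute continuity, and each of the two groups
  of intervals costs at most half of the allowed error.\<close>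

lemma abs_continuous_on_has_integral:
  fixes F f :: "real \<Rightarrow> real"
  assumes ab: "a \<le> b" and ac: "abs_continuous_on {a..b} F" and Z: "negligible Z"
    and der: "\<And>x. x \<in> {a..b} - Z \<Longrightarrow> (F has_real_derivative f x) (at x within {a..b})"
  shows "(f has_integral (F b - F a)) {a..b}"
proof (cases "a = b")
  case True
  then show ?thesis by auto
next
  case False
  with ab have ab': "a < b" by simp
  \<comment> \<open>With the integrand zero on \<open>Z\<close>, a tag in \<open>Z\<close>
    contributes only the increment of \<open>F\<close> to the error; \<open>f\<close> is arbitrary
    there.\<close>
  define g where "g x = (if x \<in> Z then 0 else f x)" for x
  have "(g has_integral (F b - F a)) (cbox a b)"
    unfolding has_integral_factor_content
  proof (intro allI impI)
    fix e :: real
    assume e: "e > 0"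
    define e2 where "e2 = e / 2"
    have e2: "e2 > 0" using e by (simp add: e2_def)
    have "\<forall>x. \<exists>d>0. x \<in> {a..b} - Z \<longrightarrow>
       (\<forall>y\<in>{a..b}. norm (y-x) < d \<longrightarrow> norm (F y - F x - f x * (y-x)) \<le> e2 * norm (y-x))"
    proof
      fix x
      show "\<exists>d>0. x \<in> {a..b} - Z \<longrightarrow>
       (\<forall>y\<in>{a..b}. norm (y-x) < d \<longrightarrow> norm (F y - F x - f x * (y-x)) \<le> e2 * norm (y-x))"
      proof (cases "x \<in> {a..b} - Z")
        case True
        from der[OF True] have "(F has_derivative (\<lambda>h. f x * h)) (at x within {a..b})"
          by (simp add: has_field_derivative_def)
        then show ?thesis using e2 unfolding has_derivative_within_alt by blast
      qed (auto intro: exI[of _ 1])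
    qed
    then obtain d where d: "\<And>x. d x > 0"
      "\<And>x y. \<lbrakk>x \<in> {a..b} - Z; y \<in> {a..b}; norm (y-x) < d x\<rbrakk>
         \<Longrightarrow> norm (F y - F x - f x * (y-x)) \<le> e2 * norm (y-x)"
      by metis
    have e3: "e2 * (b - a) > 0" using e2 ab' by simp
    obtain \<eta> where \<eta>: "\<eta> > 0"
      "\<And>D. \<lbrakk>D division_of \<Union>D; \<Union>D \<subseteq> {a..b}; (\<Sum>k\<in>D. Sup k - Inf k) < \<eta>\<rbrakk> \<Longrightarrow>
          (\<Sum>k\<in>D. \<bar>F (Sup k) - F (Inf k)\<bar>) < e2 * (b - a)"
    proof -
      from ac[unfolded abs_continuous_on_def, rule_format, OF e3] show ?thesis
        using that by blast
    qed
    have Zl: "Z \<in> sets lebesgue"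
      using Z negligible_imp_sets by blast
    obtain U where U: "open U" "Z \<subseteq> U" "U - Z \<in> lmeasurable" "emeasure lebesgue (U - Z) < ennreal \<eta>"
      using sets_lebesgue_outer_open[OF Zl \<eta>(1)] by metis
    have Ul: "U \<in> lmeasurable"
    proof -
      have "U = (U - Z) \<union> Z" using U(2) by auto
      then show ?thesis
        using U(3) negligible_imp_measurable[OF Z] by (metis fmeasurable.Un)
    qed
    have mU: "measure lebesgue U < \<eta>"
    proof -
      have "measure lebesgue (U - Z) < \<eta>"
        using U(3,4) \<eta>(1) by (simp add: emeasure_eq_measure2 ennreal_less_iff)
      moreover have "measure lebesgue (U - Z) = measure lebesgue U"
        by (rule measure_negligible_symdiff[OF Ul])
           (rule negligible_subset[OF Z], auto)
      ultimately show ?thesis by simp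
    qed
    \<comment> \<open>Intervals tagged in \<open>Z\<close> lie in \<open>U\<close>, where absolute continuity controls the increments of \<open>F\<close>.\<close>
    define \<gamma> where "\<gamma> x = (if x \<in> Z then U else ball x (d x))" for x
    have "gauge \<gamma>"
      unfolding gauge_def \<gamma>_def using U d(1) by auto
    moreover have "norm ((\<Sum>(x, k)\<in>p. measure lborel k *\<^sub>R g x) - (F b - F a)) \<le> e * measure lborel (cbox a b)"
      if p: "p tagged_division_of cbox a b" and fine: "\<gamma> fine p" for p
    proof -
      note fin = tagged_division_ofD(1)[OF p]
      have Fba: "F b - F a = (\<Sum>(x,K)\<in>p. F (Sup K) - F (Inf K))"
        using additive_tagged_division_1[OF ab, where f=F] p by simp
      have ba: "b - a = (\<Sum>(x,K)\<in>p. Sup K - Inf K)"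
        using additive_tagged_division_1[OF ab, where f="\<lambda>x. x"] p by simp
      define p1 where "p1 = {xk \<in> p. fst xk \<in> Z}"
      define p2 where "p2 = {xk \<in> p. fst xk \<notin> Z}"
      have ps: "p = p1 \<union> p2" "p1 \<inter> p2 = {}" "finite p1" "finite p2"
        using fin by (auto simp: p1_def p2_def)
      have fineD: "K \<subseteq> \<gamma> x" if "(x, K) \<in> p" for x K
        using fine that unfolding fine_def by blast
      have K: "\<exists>u v. K = {u..v} \<and> x \<in> {u..v} \<and> u \<le> v \<and> {u..v} \<subseteq> {a..b} \<and> Inf K = u \<and> Sup K = v \<and> measure lborel K = v - u"
        if "(x, K) \<in> p" for x K
      proof -
        obtain u v where uv: "K = cbox u v" using tagged_division_ofD(4)[OF p \<open>(x, K) \<in> p\<close>] by blast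
        have "x \<in> K" "K \<subseteq> cbox a b"
          using tagged_division_ofD(2,3)[OF p \<open>(x, K) \<in> p\<close>] by auto
        then show ?thesis using uv by (intro exI[of _ u] exI[of _ v]) auto
      qed
      let ?h = "\<lambda>(x,K). measure lborel K *\<^sub>R g x - (F (Sup K) - F (Inf K))"
      have "(\<Sum>(x, k)\<in>p. measure lborel k *\<^sub>R g x) - (F b - F a) = sum ?h p"
        unfolding Fba by (simp add: sum_subtractf[symmetric] split_beta)
      also have "\<dots> = sum ?h p1 + sum ?h p2"
        unfolding ps(1) by (rule sum.union_disjoint[OF ps(3,4,2)])
      finally have "norm ((\<Sum>(x, k)\<in>p. measure lborel k *\<^sub>R g x) - (F b - F a)) \<le> norm (sum ?h p1) + norm (sum ?h p2)"
        by (simp only: norm_triangle_ineq)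
      moreover have "norm (sum ?h p2) \<le> e2 * (b - a)"
      proof -
        have "norm (sum ?h p2) \<le> (\<Sum>n\<in>p2. e2 * (case n of (x, k) \<Rightarrow> Sup k - Inf k))"
        proof (rule sum_norm_le, safe)
          fix x K assume xK: "(x, K) \<in> p2"
          then have xK': "(x,K) \<in> p" "x \<notin> Z" by (auto simp: p2_def)
          obtain u v where uv: "K = {u..v}" "x \<in> {u..v}" "u \<le> v" "{u..v} \<subseteq> {a..b}"
             "Inf K = u" "Sup K = v" "measure lborel K = v - u" using K[OF xK'(1)] by blast
          have "K \<subseteq> ball x (d x)" using fineD[OF xK'(1)] xK'(2) by (simp add: \<gamma>_def)
          then have "u \<in> ball x (d x)" "v \<in> ball x (d x)"
            using uv(1,3) by (simp_all add: subset_iff del: mem_ball)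
          then have "norm (u - x) < d x" "norm (v - x) < d x"
            by (auto simp: dist_real_def)
          moreover have "x \<in> {a..b} - Z" "u \<in> {a..b}" "v \<in> {a..b}" using uv xK' by auto
          ultimately have "norm (F u - F x - f x * (u-x)) \<le> e2 * norm (u-x)"
             "norm (F v - F x - f x * (v-x)) \<le> e2 * norm (v-x)"
            using d(2) by auto
          \<comment> \<open>The tag lies between \<open>u\<close> and \<open>v\<close>, so the
            errors at the two endpoints add up to \<open>e2\<close> times the length of the
            interval.\<close>
          then have "\<bar>(v - u) * f x - (F v - F u)\<bar> \<le> e2 * (x - u) + e2 * (v - x)"
            using uv(2) by (auto simp: algebra_simps abs_le_iff)
          also have "\<dots> = e2 * (v - u)" by (simp add: algebra_simps)
          finally show "norm (measure lborel K *\<^sub>R g x - (F (Sup K) - F (Inf K))) \<le> e2 * (Sup K - Inf K)"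
            using uv xK' by (simp add: g_def)
        qed
        also have "\<dots> \<le> (\<Sum>n\<in>p. e2 * (case n of (x, k) \<Rightarrow> Sup k - Inf k))"
        proof (rule sum_mono2[OF fin])
          show "p2 \<subseteq> p" by (auto simp: p2_def)
          fix n assume "n \<in> p - p2"
          then obtain x k where "n = (x, k)" "(x, k) \<in> p" by (cases n) auto
          then show "0 \<le> e2 * (case n of (x, k) \<Rightarrow> Sup k - Inf k)"
            using K[of x k] e2 by auto
        qed
        also have "\<dots> = e2 * (b - a)"
          by (simp add: ba sum_distrib_left)
        finally show ?thesis .
      qed
      moreover have "norm (sum ?h p1) \<le> e2 * (b - a)"
      proof -
        \<comment> \<open>One interval can carry two tags only if its interior is empty. Passing
          from tagged intervals to the set of intervals therefore needs a summand that vanishes on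
          degenerate intervals; the empty set is treated apart because its \<open>Sup\<close> and
          \<open>Inf\<close> are unspecified.\<close>
        let ?d = "\<lambda>K. if K = {} then 0 else \<bar>F (Sup K) - F (Inf K)\<bar>"
        have p1: "p1 tagged_division_of (\<Union>(snd ` p1))"
          by (rule tagged_partial_division_of_Union_self[OF tagged_partial_division_subset])
            (use p in \<open>auto simp: p1_def tagged_division_of_def\<close>)
        have div: "(snd ` p1) division_of \<Union>(snd ` p1)"
          using division_of_tagged_division[OF p1] .
        have "norm (sum ?h p1) \<le> (\<Sum>(x,K)\<in>p1. ?d K)"
        proof (rule sum_norm_le, safe)
          fix x k assume "(x, k) \<in> p1"
          then have "(x, k) \<in> p" "x \<in> Z" by (auto simp: p1_def)
          then show "norm (measure lborel k *\<^sub>R g x - (F (Sup k) - F (Inf k))) \<le> ?d k"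
            using K[of x k] by (auto simp: g_def)
        qed
        also have "\<dots> = sum ?d (snd ` p1)"
          by (rule sum.over_tagged_division_lemma[OF p1]) (auto simp: box_real)
        also have "\<dots> = (\<Sum>K\<in>snd ` p1. \<bar>F (Sup K) - F (Inf K)\<bar>)"
        proof (rule sum.cong[OF refl])
          fix k assume "k \<in> snd ` p1"
          then obtain x where "(x, k) \<in> p" by (auto simp: p1_def)
          then show "?d k = \<bar>F (Sup k) - F (Inf k)\<bar>"
            using K[of x k] by auto
        qed
        also have "\<dots> < e2 * (b - a)"
        proof (rule \<eta>(2)[OF div])
          show "\<Union>(snd ` p1) \<subseteq> {a..b}"
          proof (rule Union_least)
            fix k assume "k \<in> snd ` p1"
            then obtain x where "(x, k) \<in> p" by (auto simp: p1_def)
            then show "k \<subseteq> {a..b}" using K[of x k] by metis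
          qed
          have "(\<Sum>K\<in>snd ` p1. Sup K - Inf K) = sum (measure lebesgue) (snd ` p1)"
          proof (rule sum.cong[OF refl])
            fix k assume "k \<in> snd ` p1"
            then obtain x where "(x, k) \<in> p" by (auto simp: p1_def)
            then obtain u v where "k = {u..v}" "u \<le> v" using K[of x k] by blast
            then show "Sup k - Inf k = measure lebesgue k" by (simp add: measure_completion)
          qed
          also have "\<dots> = measure lebesgue (\<Union>(snd ` p1))"
            using content_division[OF div] by simp
          also have "\<dots> \<le> measure lebesgue U"
          proof (rule measure_mono_fmeasurable)
            show "\<Union>(snd ` p1) \<subseteq> U" 

          proof (rule Union_least)
            fix k assume "k \<in> snd ` p1"
            then obtain x where "(x, k) \<in> p" "x \<in> Z" by (auto simp: p1_def)
            then show "k \<subseteq> U" using fineD[of x k] by (simp add: \<gamma>_def)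
          qed
            show "\<Union>(snd ` p1) \<in> sets lebesgue"
              using div lmeasurable_division by blast
            show "U \<in> lmeasurable" by (rule Ul)
          qed
          also have "\<dots> < \<eta>" by (rule mU)
          finally show "(\<Sum>K\<in>snd ` p1. Sup K - Inf K) < \<eta>" .
        qed
        finally show ?thesis by simp
      qed
      ultimately have "norm ((\<Sum>(x, k)\<in>p. measure lborel k *\<^sub>R g x) - (F b - F a)) \<le> e2 * (b - a) + e2 * (b - a)"
        by linarith
      then show ?thesis using ab by (simp add: e2_def field_simps)
    qed
    ultimately show "\<exists>\<gamma>. gauge \<gamma> \<and> (\<forall>p. p tagged_division_of cbox a b \<and> \<gamma> fine p \<longrightarrow>
      norm ((\<Sum>(x, k)\<in>p. measure lborel k *\<^sub>R g x) - (F b - F a)) \<le> e * measure lborel (cbox a b))"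
      by (intro exI[of _ \<gamma>] conjI allI impI) (assumption, erule conjE, assumption)
  qed
  then have "(g has_integral (F b - F a)) {a..b}" by simp
  then show ?thesis
    by (rule has_integral_spike[OF Z, rotated]) (auto simp: g_def)
qed

lemma lipschitz_on_imp_abs_continuous_on:
  assumes "C-lipschitz_on {a..b} F"
  shows "abs_continuous_on {a..b} F"
  unfolding abs_continuous_on_def
proof (intro allI impI)
  fix \<epsilon> :: real assume \<epsilon>: "\<epsilon> > 0"
  have C: "C \<ge> 0" using assms lipschitz_on_nonneg by blast
  show "\<exists>\<eta>>0. \<forall>D. D division_of \<Union>D \<and> \<Union>D \<subseteq> {a..b} \<and> (\<Sum>k\<in>D. Sup k - Inf k) < \<eta> \<longrightarrow>
      (\<Sum>k\<in>D. \<bar>F (Sup k) - F (Inf k)\<bar>) < \<epsilon>"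
  proof (intro exI[of _ "\<epsilon> / (C + 1)"] conjI allI impI)
    show "\<epsilon> / (C + 1) > 0" using \<epsilon> C by simp
    fix D :: "real set set"
    assume D: "D division_of \<Union>D \<and> \<Union>D \<subseteq> {a..b} \<and> (\<Sum>k\<in>D. Sup k - Inf k) < \<epsilon> / (C + 1)"
    have "(\<Sum>k\<in>D. \<bar>F (Sup k) - F (Inf k)\<bar>) \<le> (\<Sum>k\<in>D. C * (Sup k - Inf k))"
    proof (rule sum_mono)
      fix k assume k: "k \<in> D"
      obtain u v where uv: "k = cbox u v" "k \<noteq> {}" "k \<subseteq> {a..b}"
        using D k division_ofD(3,4)[of D "\<Union>D"] by (metis Sup_upper subset_trans)
      then have "u \<le> v" "u \<in> {a..b}" "v \<in> {a..b}" "Sup k = v" "Inf k = u" by auto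
      then show "\<bar>F (Sup k) - F (Inf k)\<bar> \<le> C * (Sup k - Inf k)"
        using lipschitz_onD[OF assms, of v u] by (simp add: dist_real_def)
    qed
    also have "\<dots> = C * (\<Sum>k\<in>D. Sup k - Inf k)" by (simp add: sum_distrib_left)
    also have "\<dots> \<le> C * (\<epsilon> / (C + 1))" using D C by (intro mult_left_mono) auto
    also have "\<dots> < \<epsilon>" using \<epsilon> C by (simp add: field_simps)
    finally show "(\<Sum>k\<in>D. \<bar>F (Sup k) - F (Inf k)\<bar>) < \<epsilon>" .
  qed
qed

text \<open>Boundedness of the density makes every function met below Lipschitz, and this class,
  unlike a bare almost-everywhere derivative, obeys the fundamental theorem and is closed under
  products and smooth compositions. The derivative is carried as a function given at every point, so
  that integrands can be compared pointwise.\<close>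

definition lipschitz_primitive :: "real \<Rightarrow> real \<Rightarrow> (real \<Rightarrow> real) \<Rightarrow> (real \<Rightarrow> real) \<Rightarrow> bool" where
  "lipschitz_primitive a b F f \<longleftrightarrow>
    (\<exists>C. C-lipschitz_on {a..b} F) \<and>
    (\<exists>Z. negligible Z \<and> (\<forall>x\<in>{a..b} - Z. (F has_real_derivative f x) (at x within {a..b})))"

lemma lipschitz_primitiveE:
  assumes "lipschitz_primitive a b F f"
  obtains C Z where "C-lipschitz_on {a..b} F" "negligible Z"
    "\<And>x. x \<in> {a..b} - Z \<Longrightarrow> (F has_real_derivative f x) (at x within {a..b})"
  using assms unfolding lipschitz_primitive_def by blast

lemma lipschitz_primitiveI:
  assumes "C-lipschitz_on {a..b} F" "negligible Z"
    "\<And>x. x \<in> {a..b} - Z \<Longrightarrow> (F has_real_derivative f x) (at x within {a..b})"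
  shows "lipschitz_primitive a b F f"
  using assms unfolding lipschitz_primitive_def by blast

lemma lipschitz_primitive_continuous_on:
  assumes "lipschitz_primitive a b F f"
  shows "continuous_on {a..b} F"
  using assms lipschitz_on_continuous_on unfolding lipschitz_primitive_def by blast

lemma lipschitz_primitive_bounded:
  assumes "lipschitz_primitive a b F f"
  obtains M where "M > 0" "\<And>x. x \<in> {a..b} \<Longrightarrow> \<bar>F x\<bar> \<le> M"
proof -
  have "bounded (F ` {a..b})"
    using lipschitz_primitive_continuous_on[OF assms]
    by (simp add: compact_continuous_image compact_imp_bounded)
  then show ?thesis
    using that unfolding bounded_pos by auto
qed

lemma lipschitz_primitive_has_integral:
  assumes "lipschitz_primitive a b F f" "a \<le> x" "x \<le> y" "y \<le> b"
  shows "(f has_integral (F y - F x)) {x..y}"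
proof -
  obtain C Z where C: "C-lipschitz_on {a..b} F" "negligible Z"
    "\<And>x. x \<in> {a..b} - Z \<Longrightarrow> (F has_real_derivative f x) (at x within {a..b})"
    using lipschitz_primitiveE[OF assms(1)] by metis
  have sub: "{x..y} \<subseteq> {a..b}" using assms by auto
  show ?thesis
  proof (rule abs_continuous_on_has_integral[OF assms(3) _ C(2)])
    show "abs_continuous_on {x..y} F"
      using abs_continuous_on_subset[OF lipschitz_on_imp_abs_continuous_on[OF C(1)] sub] .
    show "(F has_real_derivative f t) (at t within {x..y})" if "t \<in> {x..y} - Z" for t
      using that sub by (intro DERIV_subset[OF C(3) sub]) auto
  qed
qed

lemma lipschitz_primitive_spike:
  assumes "lipschitz_primitive a b F f" "negligible N" "\<And>x. x \<in> {a..b} - N \<Longrightarrow> g x = f x"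
  shows "lipschitz_primitive a b F g"
proof -
  obtain C Z where C: "C-lipschitz_on {a..b} F" "negligible Z"
    "\<And>x. x \<in> {a..b} - Z \<Longrightarrow> (F has_real_derivative f x) (at x within {a..b})"
    using lipschitz_primitiveE[OF assms(1)] by metis
  show ?thesis
    by (rule lipschitz_primitiveI[OF C(1), of "Z \<union> N"]) (use C assms in \<open>auto simp: negligible_Un\<close>)
qed

section \<open>Closure of Lipschitz primitives under algebraic operations and composition\<close>

lemma lipschitz_primitive_add:
  assumes "lipschitz_primitive a b F f" "lipschitz_primitive a b G g"
  shows "lipschitz_primitive a b (\<lambda>x. F x + G x) (\<lambda>x. f x + g x)"
proof -
  obtain C Z where C: "C-lipschitz_on {a..b} F" "negligible Z"
    "\<And>x. x \<in> {a..b} - Z \<Longrightarrow> (F has_real_derivative f x) (at x within {a..b})"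
    using lipschitz_primitiveE[OF assms(1)] by metis
  obtain D Y where D: "D-lipschitz_on {a..b} G" "negligible Y"
    "\<And>x. x \<in> {a..b} - Y \<Longrightarrow> (G has_real_derivative g x) (at x within {a..b})"
    using lipschitz_primitiveE[OF assms(2)] by metis
  show ?thesis
    by (rule lipschitz_primitiveI[OF lipschitz_on_add[OF C(1) D(1)], of "Z \<union> Y"])
       (use C D in \<open>auto simp: negligible_Un intro!: DERIV_add\<close>)
qed

lemma lipschitz_primitive_mult:
  assumes "lipschitz_primitive a b F f" "lipschitz_primitive a b G g"
  shows "lipschitz_primitive a b (\<lambda>x. F x * G x) (\<lambda>x. f x * G x + F x * g x)"
proof -
  obtain C Z where C: "C-lipschitz_on {a..b} F" "negligible Z"
    "\<And>x. x \<in> {a..b} - Z \<Longrightarrow> (F has_real_derivative f x) (at x within {a..b})"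
    using lipschitz_primitiveE[OF assms(1)] by metis
  obtain D Y where D: "D-lipschitz_on {a..b} G" "negligible Y"
    "\<And>x. x \<in> {a..b} - Y \<Longrightarrow> (G has_real_derivative g x) (at x within {a..b})"
    using lipschitz_primitiveE[OF assms(2)] by metis
  obtain M where M: "M > 0" "\<And>x. x \<in> {a..b} \<Longrightarrow> \<bar>F x\<bar> \<le> M"
    using lipschitz_primitive_bounded[OF assms(1)] by metis
  obtain N where N: "N > 0" "\<And>x. x \<in> {a..b} \<Longrightarrow> \<bar>G x\<bar> \<le> N"
    using lipschitz_primitive_bounded[OF assms(2)] by metis
  have C0: "C \<ge> 0" and D0: "D \<ge> 0" using C(1) D(1) lipschitz_on_nonneg by blast+
  show ?thesis
  proof (rule lipschitz_primitiveI)
    show "(M * D + N * C)-lipschitz_on {a..b} (\<lambda>x. F x * G x)"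
    proof (rule lipschitz_onI)
      fix x y assume xy: "x \<in> {a..b}" "y \<in> {a..b}"
      have "F x * G x - F y * G y = F x * (G x - G y) + G y * (F x - F y)"
        by (simp add: algebra_simps)
      then have "\<bar>F x * G x - F y * G y\<bar> \<le> \<bar>F x\<bar> * \<bar>G x - G y\<bar> + \<bar>G y\<bar> * \<bar>F x - F y\<bar>"
        by (metis abs_mult abs_triangle_ineq)
      also have "\<dots> \<le> M * (D * \<bar>x - y\<bar>) + N * (C * \<bar>x - y\<bar>)"
        using lipschitz_onD[OF C(1) xy] lipschitz_onD[OF D(1) xy] M N xy
        by (intro add_mono mult_mono) (auto simp: dist_real_def less_imp_le)
      finally show "dist (F x * G x) (F y * G y) \<le> (M * D + N * C) * dist x y"
        by (simp add: dist_real_def algebra_simps)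
    qed (use M N C0 D0 in auto)
    show "negligible (Z \<union> Y)" using C D by (simp add: negligible_Un)
    show "((\<lambda>x. F x * G x) has_real_derivative f x * G x + F x * g x) (at x within {a..b})"
      if "x \<in> {a..b} - (Z \<union> Y)" for x
      using DERIV_mult[OF C(3) D(3)] that by (simp add: mult.commute)
  qed
qed

lemma lipschitz_on_bounded_deriv:
  fixes \<phi> \<phi>' :: "real \<Rightarrow> real"
  assumes "\<And>x. x \<in> {a..b} \<Longrightarrow> (\<phi> has_real_derivative \<phi>' x) (at x within {a..b})"
    and "\<And>x. x \<in> {a..b} \<Longrightarrow> \<bar>\<phi>' x\<bar> \<le> B" "B \<ge> 0"
  shows "B-lipschitz_on {a..b} \<phi>"
proof (rule bounded_derivative_imp_lipschitz)
  show "(\<phi> has_derivative (\<lambda>h. \<phi>' x * h)) (at x within {a..b})" if "x \<in> {a..b}" for x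
    using assms(1)[OF that] by (simp add: has_field_derivative_def)
  show "onorm (\<lambda>h. \<phi>' x * h) \<le> B" if "x \<in> {a..b}" for x
    using assms(2)[OF that] by (intro onorm_le) (simp add: abs_mult mult_right_mono)
qed (use assms in auto)

lemma lipschitz_primitive_of_continuous_deriv:
  fixes u v :: "real \<Rightarrow> real"
  assumes "\<And>x. x \<in> {a..b} \<Longrightarrow> (u has_real_derivative v x) (at x within {a..b})"
    and "continuous_on {a..b} v"
  shows "lipschitz_primitive a b u v"
proof -
  have "bounded (v ` {a..b})"
    using assms(2) by (simp add: compact_continuous_image compact_imp_bounded)
  then obtain B where "B > 0" "\<And>x. x \<in> {a..b} \<Longrightarrow> \<bar>v x\<bar> \<le> B"
    unfolding bounded_pos by auto
  then have "B-lipschitz_on {a..b} u"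
    using assms(1) by (intro lipschitz_on_bounded_deriv[where \<phi>'=v]) auto
  then show ?thesis
    using assms(1) by (intro lipschitz_primitiveI[of B _ _ _ "{}"]) auto
qed

lemma lipschitz_primitive_compose:
  fixes \<phi> \<phi>' :: "real \<Rightarrow> real"
  assumes "lipschitz_primitive a b F f"
    and \<phi>: "\<And>y. (\<phi> has_real_derivative \<phi>' y) (at y)" and cont: "continuous_on UNIV \<phi>'"
  shows "lipschitz_primitive a b (\<lambda>x. \<phi> (F x)) (\<lambda>x. \<phi>' (F x) * f x)"
proof -
  obtain C Z where C: "C-lipschitz_on {a..b} F" "negligible Z"
    "\<And>x. x \<in> {a..b} - Z \<Longrightarrow> (F has_real_derivative f x) (at x within {a..b})"
    using lipschitz_primitiveE[OF assms(1)] by metis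
  obtain M where M: "M > 0" "\<And>x. x \<in> {a..b} \<Longrightarrow> \<bar>F x\<bar> \<le> M"
    using lipschitz_primitive_bounded[OF assms(1)] by metis
  have "lipschitz_primitive (-M) M \<phi> \<phi>'"
    using \<phi> cont by (intro lipschitz_primitive_of_continuous_deriv)
      (auto intro: has_field_derivative_at_within continuous_on_subset)
  then obtain B where B: "B-lipschitz_on {-M..M} \<phi>"
    using lipschitz_primitiveE by metis
  have "F ` {a..b} \<subseteq> {-M..M}" using M(2) by (auto simp: abs_le_iff minus_le_iff)
  then have "B-lipschitz_on (F ` {a..b}) \<phi>" using lipschitz_on_subset[OF B] by blast
  from lipschitz_on_compose2[OF C(1) this]
  have "(B * C)-lipschitz_on {a..b} (\<lambda>x. \<phi> (F x))" .
  then show ?thesis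
    by (rule lipschitz_primitiveI[OF _ C(2)]) (intro DERIV_chain2[OF \<phi> C(3)], assumption)
qed

lemma lipschitz_primitive_const: "lipschitz_primitive a b (\<lambda>x. c) (\<lambda>x. 0)"
  by (rule lipschitz_primitiveI[of 0 _ _ _ "{}"]) (auto intro: lipschitz_intros)

lemma lipschitz_primitive_cmult:
  assumes "lipschitz_primitive a b F f"
  shows "lipschitz_primitive a b (\<lambda>x. c * F x) (\<lambda>x. c * f x)"
  using lipschitz_primitive_mult[OF lipschitz_primitive_const assms, of c] by simp

text \<open>The entry point for the derivative of an eigenfunction, which is only assumed absolutely
  continuous: integrating a derivative that is bounded off a null set yields a Lipschitz
  constant.\<close>

lemma lipschitz_primitive_of_abs_continuous:
  assumes "abs_continuous_on {a..b} F" "negligible Z"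
    and der: "\<And>x. x \<in> {a..b} - Z \<Longrightarrow> (F has_real_derivative f x) (at x within {a..b})"
    and bd: "\<And>x. x \<in> {a..b} - Z \<Longrightarrow> \<bar>f x\<bar> \<le> B" and "B \<ge> 0"
  shows "lipschitz_primitive a b F f"
proof -
  have *: "\<bar>F y - F x\<bar> \<le> B * (y - x)" if xy: "a \<le> x" "x \<le> y" "y \<le> b" for x y
  proof -
    have sub: "{x..y} \<subseteq> {a..b}" using xy by auto
    have "(f has_integral F y - F x) {x..y}"
    proof (rule abs_continuous_on_has_integral[OF xy(2) _ assms(2)])
      show "abs_continuous_on {x..y} F" using abs_continuous_on_subset[OF assms(1) sub] .
      show "(F has_real_derivative f t) (at t within {x..y})" if "t \<in> {x..y} - Z" for t
        using that sub by (intro DERIV_subset[OF der sub]) auto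
    qed
    then have "((\<lambda>t. if t \<in> Z then 0 else f t) has_integral F y - F x) {x..y}"
      by (rule has_integral_spike[OF assms(2), rotated]) auto
    from has_integral_bound_real[OF assms(5) _ this, of "{}"] bd sub \<open>B \<ge> 0\<close>
    show ?thesis using xy by auto
  qed
  have "B-lipschitz_on {a..b} F"
  proof (rule lipschitz_onI[OF _ assms(5)])
    fix x y assume "x \<in> {a..b}" "y \<in> {a..b}"
    then show "dist (F x) (F y) \<le> B * dist x y"
      using *[of x y] *[of y x] by (cases "x \<le> y") (auto simp: dist_real_def abs_minus_commute)
  qed
  then show ?thesis using assms(2) der by (rule lipschitz_primitiveI)
qed

section \<open>Comparison of increments through their derivatives\<close>

lemma lipschitz_primitive_le:
  assumes "lipschitz_primitive a b F f" "lipschitz_primitive a b G g"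
    and "a \<le> x" "x \<le> y" "y \<le> b" and "\<And>t. t \<in> {x..y} \<Longrightarrow> f t \<le> g t"
  shows "F y - F x \<le> G y - G x"
  using has_integral_le[OF lipschitz_primitive_has_integral[OF assms(1,3-5)]
    lipschitz_primitive_has_integral[OF assms(2,3-5)] assms(6)] by simp

lemma lipschitz_primitive_abs_le:
  assumes "lipschitz_primitive a b F f" "lipschitz_primitive a b G g"
    and "a \<le> x" "x \<le> y" "y \<le> b" and "\<And>t. t \<in> {x..y} \<Longrightarrow> \<bar>f t\<bar> \<le> g t"
  shows "\<bar>F y - F x\<bar> \<le> G y - G x"
proof -
  have "F y - F x \<le> G y - G x"
    by (rule lipschitz_primitive_le[OF assms(1-5)]) (use assms(6) in \<open>auto simp: abs_le_iff\<close>)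
  moreover have "-1 * F y - -1 * F x \<le> G y - G x"
    by (rule lipschitz_primitive_le[OF lipschitz_primitive_cmult[OF assms(1)] assms(2-5)])
       (use assms(6) in \<open>auto simp: abs_le_iff\<close>)
  ultimately show ?thesis by (simp add: abs_le_iff)
qed

section \<open>Differentiation of indefinite integrals and Caratheodory equations\<close>

text \<open>Lebesgue's differentiation theorem is used in a form that controls right-hand averages
  at almost every point; applied to the reflected function it controls the left-hand ones, and the
  two exceptional sets are united.\<close>

lemma lipschitz_primitive_indefinite_integral:
  fixes f :: "real \<Rightarrow> real"
  assumes int: "f integrable_on {a..b}" and bd: "\<And>x. x \<in> {a..b} \<Longrightarrow> \<bar>f x\<bar> \<le> B" and B: "B \<ge> 0"
  shows "lipschitz_primitive a b (\<lambda>x. integral {a..x} f) f"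
proof -
  define F where "F x = integral {a..x} f" for x
  \<comment> \<open>Extension by zero, because the differentiation theorem is applied to a function
    integrable on every bounded interval.\<close>
  define h where "h x = (if x \<in> {a..b} then f x else 0)" for x
  have "h integrable_on UNIV"
    unfolding h_def using int integrable_restrict_UNIV[of "{a..b}" f] by simp
  then have hint: "h integrable_on cbox u v" for u v
    using integrable_on_subcbox by blast
  have h'int: "(\<lambda>x. h (- x)) integrable_on cbox u v" for u v
    using hint[of "-v" "-u"] integrable_reflect[of h "-u" "-v"] by (simp del: integrable_reflect)
  obtain N1 where N1: "negligible N1"
    "\<And>x e. \<lbrakk>x \<notin> N1; 0 < e\<rbrakk> \<Longrightarrow> \<exists>d>0. \<forall>t. 0 < t \<and> t < d \<longrightarrow> \<bar>integral {x..x + t} h / t - h x\<bar> < e"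
    using integrable_ccontinuous_explicit[of h, OF hint] by (auto simp: divide_inverse mult.commute)
  obtain N2 where N2: "negligible N2"
    "\<And>x e. \<lbrakk>x \<notin> N2; 0 < e\<rbrakk> \<Longrightarrow>
      \<exists>d>0. \<forall>t. 0 < t \<and> t < d \<longrightarrow> \<bar>integral {x..x + t} (\<lambda>x. h (- x)) / t - h (- x)\<bar> < e"
    using integrable_ccontinuous_explicit[of "\<lambda>x. h (- x)", OF h'int] by (auto simp: divide_inverse mult.commute)
  have diff: "F y - F x = integral {x..y} h" if "a \<le> x" "x \<le> y" "y \<le> b" for x y
  proof -
    have "f integrable_on {a..y}" by (rule integrable_on_subinterval[OF int]) (use that in auto)
    from Henstock_Kurzweil_Integration.integral_combine[OF that(1,2) this]
    have "F y - F x = integral {x..y} f" by (simp add: F_def)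
    also have "\<dots> = integral {x..y} h"
      by (rule integral_cong) (use that in \<open>auto simp: h_def\<close>)
    finally show ?thesis .
  qed
  have der: "(F has_real_derivative f x) (at x within {a..b})"
    if x: "x \<in> {a..b} - (N1 \<union> uminus ` N2)" for x
    unfolding has_field_derivative_iff Lim_within
  proof (intro allI impI)
    fix e :: real assume e: "e > 0"
    have "x \<notin> N1" "- x \<notin> N2" using x by force+
    then obtain d1 d2 where d: "d1 > 0" "d2 > 0"
      "\<And>t. 0 < t \<Longrightarrow> t < d1 \<Longrightarrow> \<bar>integral {x..x + t} h / t - h x\<bar> < e"
      "\<And>t. 0 < t \<Longrightarrow> t < d2 \<Longrightarrow> \<bar>integral {- x..- x + t} (\<lambda>x. h (- x)) / t - h x\<bar> < e"
      using N1(2)[OF _ e, of x] N2(2)[OF _ e, of "-x"] by (metis minus_minus)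
    have hx: "h x = f x" using x by (simp add: h_def)
    have "dist ((F y - F x) / (y - x)) (f x) < e" if y: "y \<in> {a..b}" "0 < dist y x" "dist y x < min d1 d2" for y
    proof (cases "x < y")
      case True
      then show ?thesis
        using d(3)[of "y - x"] diff[of x y] y x hx by (simp add: dist_real_def)
    next
      case False
      with y have yx: "y < x" by simp
      have "integral {- x..- y} (\<lambda>x. h (- x)) = integral {y..x} h" by simp
      moreover have "(F y - F x) / (y - x) = (F x - F y) / (x - y)"
        using minus_divide_divide[of "F x - F y" "x - y"] by simp
      ultimately show ?thesis
        using d(4)[of "x - y"] diff[of y x] y x hx yx by (simp add: dist_real_def)
    qed
    then show "\<exists>d>0. \<forall>y\<in>{a..b}. 0 < dist y x \<and> dist y x < d \<longrightarrow> dist ((F y - F x) / (y - x)) (f x) < e"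
      using d(1,2) by (intro exI[of _ "min d1 d2"]) auto
  qed
  have neg: "negligible (N1 \<union> uminus ` N2)"
    using N1(1) N2(1) by (auto intro!: negligible_Un negligible_differentiable_image_negligible derivative_intros
      simp: differentiable_on_def)
  have lip: "B-lipschitz_on {a..b} F"
  proof (rule lipschitz_on_leI[OF _ B])
    fix x y assume xy: "x \<in> {a..b}" "y \<in> {a..b}" "x \<le> y"
    have "\<bar>integral {x..y} h\<bar> \<le> B * (y - x)"
      using integrable_integral[OF hint[of x y]] has_integral_bound_real[OF B finite.emptyI, of h _ x y] bd xy
      by (auto simp: h_def)
    then show "dist (F x) (F y) \<le> B * dist x y"
      using diff[of x y] xy by (auto simp: dist_real_def abs_minus_commute)
  qed
  show ?thesis using lipschitz_primitiveI[OF lip neg der] by (simp add: F_def[abs_def])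
qed

text \<open>Picard's contraction argument. The Lipschitz bound in \<open>y\<close> is global, so an
  exponentially weighted norm gives one fixed point on the whole of \<open>{0..1}\<close>, without
  continuation from short intervals. Dependence on \<open>t\<close> is controlled by integrability
  along continuous functions, as a merely measurable density requires.\<close>

lemma caratheodory_existence:
  fixes G :: "real \<Rightarrow> real \<Rightarrow> real"
  assumes int: "\<And>\<phi>. continuous_on {0..1} \<phi> \<Longrightarrow> (\<lambda>t. G t (\<phi> t)) integrable_on {0..1}"
    and bd: "\<And>t y. t \<in> {0..1} \<Longrightarrow> \<bar>G t y\<bar> \<le> B"
    and lip: "\<And>t y z. t \<in> {0..1} \<Longrightarrow> \<bar>G t y - G t z\<bar> \<le> L * \<bar>y - z\<bar>" and L: "L > 0"
  obtains \<phi> where "continuous_on {0..1} \<phi>" "\<And>x. x \<in> {0..1} \<Longrightarrow> \<phi> x = integral {0..x} (\<lambda>t. G t (\<phi> t))"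
proof -
  \<comment> \<open>The complete space used is that of bounded continuous functions on the whole
    line; clamping the argument to \<open>{0..1}\<close> lets the integral operator act on
    it.\<close>
  define cl :: "real \<Rightarrow> real" where "cl x = max 0 (min 1 x)" for x
  have cl: "cl x \<in> {0..1}" and cl_id: "x \<in> {0..1} \<Longrightarrow> cl x = x" for x by (auto simp: cl_def)
  \<comment> \<open>In terms of \<open>\<psi> = exp (- 2 L x) \<phi>\<close> the integral operator contracts the supremum norm by 1/2.\<close>
  define T where "T \<psi> x = exp (- (2 * L * cl x)) * integral {0..cl x} (\<lambda>t. G t (exp (2 * L * t) * \<psi> t))"
    for \<psi> x
  have B: "B \<ge> 0" using bd[of 0 0] by (smt (verit) atLeastAtMost_iff zero_le_one)
  have G_int: "(\<lambda>t. G t (exp (2 * L * t) * apply_bcontfun \<psi> t)) integrable_on {0..c}" if "c \<in> {0..1}" for \<psi> c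
    by (rule integrable_on_subinterval[OF int]) (use that in \<open>auto intro!: continuous_intros\<close>)
  have T: "T (apply_bcontfun \<psi>) \<in> bcontfun" for \<psi>
  proof (rule bcontfun_normI)
    have "continuous_on {0..1} (\<lambda>c. integral {0..c} (\<lambda>t. G t (exp (2 * L * t) * apply_bcontfun \<psi> t)))"
      by (rule indefinite_integral_continuous_1[OF G_int[of 1 \<psi>, simplified]])
    moreover have "continuous_on UNIV cl" unfolding cl_def by (intro continuous_intros)
    ultimately have "continuous_on UNIV (\<lambda>x. integral {0..cl x} (\<lambda>t. G t (exp (2 * L * t) * apply_bcontfun \<psi> t)))"
      by (rule continuous_on_compose2) (use cl in blast)
    with \<open>continuous_on UNIV cl\<close> show "continuous_on UNIV (T (apply_bcontfun \<psi>))"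
      unfolding T_def by (intro continuous_intros)
    fix x
    have "\<bar>integral {0..cl x} (\<lambda>t. G t (exp (2 * L * t) * apply_bcontfun \<psi> t))\<bar> \<le> B * (cl x - 0)"
      using has_integral_bound_real[OF B finite.emptyI integrable_integral[OF G_int[OF cl[of x], where \<psi>=\<psi>]]] bd cl[of x]
      by auto
    also have "\<dots> \<le> B" using cl[of x] B by (simp add: mult_left_le)
    finally show "norm (T (apply_bcontfun \<psi>) x) \<le> B"
      using cl[of x] L mult_mono[of "exp (- (2 * L * cl x))" 1 _ B] by (simp add: T_def abs_mult)
  qed
  define \<Phi> where "\<Phi> \<psi> = Bcontfun (T (apply_bcontfun \<psi>))" for \<psi>
  have \<Phi>: "apply_bcontfun (\<Phi> \<psi>) = T (apply_bcontfun \<psi>)" for \<psi>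
    unfolding \<Phi>_def by (rule Bcontfun_inverse[OF T])
  have "dist (\<Phi> \<psi>) (\<Phi> \<zeta>) \<le> 1/2 * dist \<psi> \<zeta>" for \<psi> \<zeta>
  proof (rule dist_bound)
    fix x
    let ?D = "dist \<psi> \<zeta>" and ?c = "cl x"
    let ?g = "\<lambda>\<psi> t. G t (exp (2 * L * t) * apply_bcontfun \<psi> t)"
    have "((\<lambda>t. L * exp (2 * L * t) * ?D) has_integral exp (2 * L * ?c) * ?D / 2 - exp (2 * L * 0) * ?D / 2) {0..?c}"
      using cl[of x]
      by (intro fundamental_theorem_of_calculus)
         (auto intro!: derivative_eq_intros simp: has_real_derivative_iff_has_vector_derivative[symmetric])
    then have I: "((\<lambda>t. L * exp (2 * L * t) * ?D) has_integral (exp (2 * L * ?c) - 1) * ?D / 2) {0..?c}"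
      by (simp add: algebra_simps diff_divide_distrib)
    have "\<bar>integral {0..?c} (?g \<psi>) - integral {0..?c} (?g \<zeta>)\<bar> = norm (integral {0..?c} (\<lambda>t. ?g \<psi> t - ?g \<zeta> t))"
      using G_int[OF cl] by (subst integral_diff) auto
    also have "\<dots> \<le> integral {0..?c} (\<lambda>t. L * exp (2 * L * t) * ?D)"
    proof (rule integral_norm_bound_integral)
      show "(\<lambda>t. ?g \<psi> t - ?g \<zeta> t) integrable_on {0..?c}" using G_int[OF cl] by (intro integrable_diff)
      show "(\<lambda>t. L * exp (2 * L * t) * ?D) integrable_on {0..?c}" using I by blast
      fix t assume "t \<in> {0..?c}"
      then have "t \<in> {0..1}" using cl[of x] by auto
      then have "norm (?g \<psi> t - ?g \<zeta> t) \<le> L * \<bar>exp (2 * L * t) * apply_bcontfun \<psi> t - exp (2 * L * t) * apply_bcontfun \<zeta> t\<bar>"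
        using lip by simp
      also have "\<dots> = L * exp (2 * L * t) * dist (apply_bcontfun \<psi> t) (apply_bcontfun \<zeta> t)"
        by (simp add: dist_real_def abs_mult flip: right_diff_distrib)
      also have "\<dots> \<le> L * exp (2 * L * t) * ?D"
        using L by (intro mult_left_mono dist_bounded) auto
      finally show "norm (?g \<psi> t - ?g \<zeta> t) \<le> L * exp (2 * L * t) * ?D" .
    qed
    also have "\<dots> = (exp (2 * L * ?c) - 1) * ?D / 2" using I by blast
    finally have "\<bar>integral {0..?c} (?g \<psi>) - integral {0..?c} (?g \<zeta>)\<bar> \<le> (exp (2 * L * ?c) - 1) * ?D / 2" .
    then have "exp (- (2 * L * ?c)) * \<bar>integral {0..?c} (?g \<psi>) - integral {0..?c} (?g \<zeta>)\<bar>
      \<le> exp (- (2 * L * ?c)) * ((exp (2 * L * ?c) - 1) * ?D / 2)" by (intro mult_left_mono) auto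
    also have "\<dots> = (1 - exp (- (2 * L * ?c))) * ?D / 2"
      by (simp add: algebra_simps exp_minus)
    also have "\<dots> \<le> 1 / 2 * ?D"
      using mult_right_mono[of "1 - exp (- (2 * L * ?c))" 1 ?D] by simp
    finally show "dist (apply_bcontfun (\<Phi> \<psi>) x) (apply_bcontfun (\<Phi> \<zeta>) x) \<le> 1/2 * ?D"
      by (simp add: \<Phi> T_def dist_real_def abs_mult flip: right_diff_distrib)
  qed
  then obtain \<psi> where \<psi>: "\<Phi> \<psi> = \<psi>"
    using banach_fix_type[of "1/2" \<Phi>] by auto
  define \<phi> where "\<phi> t = exp (2 * L * t) * apply_bcontfun \<psi> t" for t
  show ?thesis
  proof (rule that)
    show "continuous_on {0..1} \<phi>" unfolding \<phi>_def by (intro continuous_intros) simp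
    show "\<phi> x = integral {0..x} (\<lambda>t. G t (\<phi> t))" if "x \<in> {0..1}" for x
    proof -
      have "apply_bcontfun \<psi> x = T (apply_bcontfun \<psi>) x" using \<Phi>[of \<psi>] \<psi> by simp
      then show ?thesis using cl_id[OF that] by (simp add: \<phi>_def T_def exp_minus)
    qed
  qed
qed

section \<open>The string equation and Pruefer coordinates\<close>

text \<open>\<open>u\<close> is the integral of \<open>v\<close>, and the integral of a continuous
  function is differentiable everywhere. Thus an identity for the derivative found off a null set
  gives a true derivative at each point.\<close>

lemma lipschitz_primitive_continuous_deriv:
  assumes "lipschitz_primitive a b u v" "continuous_on {a..b} v" "x \<in> {a..b}"
  shows "(u has_real_derivative v x) (at x within {a..b})"
proof -
  have "((\<lambda>y. u a + integral {a..y} v) has_real_derivative 0 + v x) (at x within {a..b})"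
    using integral_has_real_derivative[OF assms(2,3)] by (intro DERIV_add) auto
  moreover have "u a + integral {a..y} v = u y" if "y \<in> {a..b}" for y
    using lipschitz_primitive_has_integral[OF assms(1), of a y] that by (auto dest: integral_unique)
  ultimately show ?thesis
    using has_field_derivative_transform_within[OF _ zero_less_one assms(3)] by simp
qed

text \<open>Encodes u' = v and u'' = - \<rho> w. The source \<open>w\<close> is kept separate from
  \<open>u\<close>, so that one notion covers eigenfunctions, with \<open>w\<close> a multiple of
  \<open>u\<close>, and the links of a chain, where \<open>w\<close> is the next member; it is also
  linear in the triple.\<close>

definition string_equation ::
  "(real \<Rightarrow> real) \<Rightarrow> (real \<Rightarrow> real) \<Rightarrow> (real \<Rightarrow> real) \<Rightarrow> (real \<Rightarrow> real) \<Rightarrow> bool" where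
  "string_equation \<rho> u v w \<longleftrightarrow>
    (\<forall>x\<in>{0..1}. (u has_real_derivative v x) (at x within {0..1})) \<and>
    lipschitz_primitive 0 1 v (\<lambda>x. - (\<rho> x * w x))"

lemma string_equation_continuous_deriv:
  assumes "string_equation \<rho> u v w"
  shows "continuous_on {0..1} v"
  using assms lipschitz_primitive_continuous_on unfolding string_equation_def by blast

lemma string_equation_lipschitz_primitive:
  assumes "string_equation \<rho> u v w"
  shows "lipschitz_primitive 0 1 u v"
  using assms string_equation_continuous_deriv[OF assms]
  by (intro lipschitz_primitive_of_continuous_deriv) (auto simp: string_equation_def)

lemma string_equation_continuous:
  assumes "string_equation \<rho> u v w"
  shows "continuous_on {0..1} u"
  using string_equation_lipschitz_primitive[OF assms] by (rule lipschitz_primitive_continuous_on)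

lemma string_equation_cmult:
  assumes "string_equation \<rho> u v w"
  shows "string_equation \<rho> (\<lambda>x. c * u x) (\<lambda>x. c * v x) (\<lambda>x. c * w x)"
  using assms lipschitz_primitive_cmult[of 0 1 v "\<lambda>x. - (\<rho> x * w x)" c]
  by (auto simp: string_equation_def mult.left_commute intro!: DERIV_cmult)

lemma string_equation_add:
  assumes "string_equation \<rho> u v w" "string_equation \<rho> u' v' w'"
  shows "string_equation \<rho> (\<lambda>x. u x + u' x) (\<lambda>x. v x + v' x) (\<lambda>x. w x + w' x)"
  using assms lipschitz_primitive_add[of 0 1 v "\<lambda>x. - (\<rho> x * w x)" v' "\<lambda>x. - (\<rho> x * w' x)"]
  by (auto simp: string_equation_def algebra_simps intro!: DERIV_add)

lemma string_equation_sum: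
  assumes "\<And>i. i \<in> S \<Longrightarrow> string_equation \<rho> (u i) (v i) (w i)"
  shows "string_equation \<rho> (\<lambda>x. \<Sum>i\<in>S. u i x) (\<lambda>x. \<Sum>i\<in>S. v i x) (\<lambda>x. \<Sum>i\<in>S. w i x)"
  using assms
proof (induction S rule: infinite_finite_induct)
  case (insert i S)
  then show ?case using string_equation_add[of \<rho> "u i" "v i" "w i"] by simp
qed (auto simp: string_equation_def lipschitz_primitive_const)

text \<open>The bounds are required at every point to keep null sets out of the estimates. A density
  that satisfies them only almost everywhere is truncated before it enters.\<close>

locale bounded_density =
  fixes \<rho> :: "real \<Rightarrow> real" and K :: real
  assumes K: "K \<ge> 1"
    and measurable: "\<rho> \<in> borel_measurable (lebesgue_on {0..1})"
    and lower: "\<And>x. x \<in> {0..1} \<Longrightarrow> 1 / K \<le> \<rho> x"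
    and upper: "\<And>x. x \<in> {0..1} \<Longrightarrow> \<rho> x \<le> K"
begin

lemma K_pos: "K > 0" using K by simp

lemma pos: "x \<in> {0..1} \<Longrightarrow> \<rho> x > 0"
  using lower[of x] K by (smt (verit) divide_pos_pos)

lemma absolutely_integrable_mult:
  assumes "continuous_on {0..1} h"
  shows "(\<lambda>x. \<rho> x * h x) absolutely_integrable_on {0..1}"
proof (rule absolutely_integrable_bounded_measurable_product_real[OF measurable])
  show "bounded (\<rho> ` {0..1})"
    unfolding bounded_iff using pos upper by (intro exI[of _ K]) (force simp: abs_of_pos)
  show "h absolutely_integrable_on {0..1}"
    using absolutely_integrable_continuous_real[OF assms] .
qed simp

lemma integrable_mult:
  assumes "continuous_on {0..1} h"
  shows "(\<lambda>x. \<rho> x * h x) integrable_on {0..1}"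
  using absolutely_integrable_mult[OF assms] set_lebesgue_integral_eq_integral(1) by blast

text \<open>Substituting u = e^q sin \<theta> and u' = L e^q cos \<theta> into u'' = -L^2 \<rho> u
  and solving for the two derivatives gives these equations. The phase equation is closed, bounded
  and Lipschitz in \<theta>, so it is solved first; \<open>q\<close> is then an indefinite integral,
  bounded by \<open>L * K\<close> because \<bar>1 - \<rho>\<bar> \<le> K.\<close>

lemma pruefer_existence:
  assumes L: "L > 0"
  obtains \<theta> q where
    "lipschitz_primitive 0 1 \<theta> (\<lambda>x. L * ((cos (\<theta> x))\<^sup>2 + \<rho> x * (sin (\<theta> x))\<^sup>2))"
    "lipschitz_primitive 0 1 q (\<lambda>x. L * ((1 - \<rho> x) * (sin (\<theta> x) * cos (\<theta> x))))"
    "\<And>x. x \<in> {0..1} \<Longrightarrow> \<bar>q x\<bar> \<le> L * K"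
proof -
  define G where "G t y = L * ((cos y)\<^sup>2 + \<rho> t * (sin y)\<^sup>2)" for t y
  have G_int: "(\<lambda>t. G t (\<phi> t)) integrable_on {0..1}" if "continuous_on {0..1} \<phi>" for \<phi>
  proof -
    have "(\<lambda>t. L * (cos (\<phi> t))\<^sup>2) integrable_on {0..1}"
      using that by (intro integrable_continuous_real continuous_intros)
    moreover have "(\<lambda>t. \<rho> t * (L * (sin (\<phi> t))\<^sup>2)) integrable_on {0..1}"
      using that by (intro integrable_mult continuous_intros)
    ultimately have "(\<lambda>t. L * (cos (\<phi> t))\<^sup>2 + \<rho> t * (L * (sin (\<phi> t))\<^sup>2)) integrable_on {0..1}"
      by (rule integrable_add)
    then show ?thesis by (simp add: G_def algebra_simps)
  qed
  have rho_eq: "(cos y)\<^sup>2 + r * (sin y)\<^sup>2 = 1 + (r - 1) * (sin y)\<^sup>2" for r y :: real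
    by (simp add: cos_squared_eq algebra_simps)
  have rho1: "\<bar>\<rho> t - 1\<bar> \<le> K" if "t \<in> {0..1}" for t
    using pos[OF that] upper[OF that] K by auto
  have G_bd: "\<bar>G t y\<bar> \<le> L * K" if "t \<in> {0..1}" for t y
  proof -
    have "(cos y)\<^sup>2 + \<rho> t * (sin y)\<^sup>2 \<le> K * (cos y)\<^sup>2 + K * (sin y)\<^sup>2"
      using upper[OF that] K by (intro add_mono mult_right_mono) (auto simp: mult_le_cancel_right1)
    also have "\<dots> = K" by (simp flip: distrib_left)
    finally show ?thesis
      using pos[OF that] L by (auto simp: G_def abs_mult)
  qed
  have G_lip: "\<bar>G t y - G t z\<bar> \<le> 2 * L * K * \<bar>y - z\<bar>" if t: "t \<in> {0..1}" for t y z
  proof -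
    have sin_lip: "\<bar>sin y - sin z\<bar> \<le> \<bar>y - z\<bar>"
    proof -
      have "sin y - sin z = 2 * sin ((y - z) / 2) * cos ((y + z) / 2)"
        using sin_diff_sin[of y z] by simp
      then have "\<bar>sin y - sin z\<bar> = 2 * \<bar>sin ((y - z) / 2)\<bar> * \<bar>cos ((y + z) / 2)\<bar>"
        by (simp add: abs_mult)
      also have "\<dots> \<le> 2 * \<bar>(y - z) / 2\<bar> * 1"
        using abs_sin_x_le_abs_x[of "(y - z) / 2"] by (intro mult_mono) auto
      finally show ?thesis by simp
    qed
    have "G t y - G t z = L * ((\<rho> t - 1) * ((sin y - sin z) * (sin y + sin z)))"
      unfolding G_def rho_eq by (simp add: algebra_simps power2_eq_square)
    then have "\<bar>G t y - G t z\<bar> = L * (\<bar>\<rho> t - 1\<bar> * (\<bar>sin y - sin z\<bar> * \<bar>sin y + sin z\<bar>))"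
      using L by (simp add: abs_mult)
    also have "\<dots> \<le> L * (K * (\<bar>y - z\<bar> * 2))"
    proof -
      have "\<bar>sin y + sin z\<bar> \<le> 2"
        using abs_triangle_ineq[of "sin y" "sin z"] abs_sin_le_one[of y] abs_sin_le_one[of z] by linarith
      then show ?thesis
        using sin_lip rho1[OF t] L K by (intro mult_left_mono mult_mono) auto
    qed
    finally show ?thesis by (simp add: mult_ac)
  qed
  have "2 * L * K > 0" using L K_pos by simp
  then obtain \<phi> where \<phi>: "continuous_on {0..1} \<phi>"
     "\<And>x. x \<in> {0..1} \<Longrightarrow> \<phi> x = integral {0..x} (\<lambda>t. G t (\<phi> t))"
    using caratheodory_existence[of G "L * K" "2 * L * K", OF G_int G_bd G_lip] by metis
  define \<theta> where "\<theta> x = integral {0..x} (\<lambda>t. G t (\<phi> t))" for x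
  have \<theta>\<phi>: "\<theta> x = \<phi> x" if "x \<in> {0..1}" for x using \<phi>(2)[OF that] by (simp add: \<theta>_def)
  have "lipschitz_primitive 0 1 \<theta> (\<lambda>t. G t (\<phi> t))"
    unfolding \<theta>_def[abs_def]
    using L K by (intro lipschitz_primitive_indefinite_integral[OF G_int[OF \<phi>(1)], of "L * K"] G_bd) auto
  then have \<theta>: "lipschitz_primitive 0 1 \<theta> (\<lambda>x. L * ((cos (\<theta> x))\<^sup>2 + \<rho> x * (sin (\<theta> x))\<^sup>2))"
    by (rule lipschitz_primitive_spike[of _ _ _ _ "{}"]) (auto simp: \<theta>\<phi> G_def)
  note \<theta>c = lipschitz_primitive_continuous_on[OF \<theta>]
  define p where "p x = L * ((1 - \<rho> x) * (sin (\<theta> x) * cos (\<theta> x)))" for x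
  have p_int: "p integrable_on {0..1}"
  proof -
    have "(\<lambda>x. L * (sin (\<theta> x) * cos (\<theta> x))) integrable_on {0..1}"
      using \<theta>c by (intro integrable_continuous_real continuous_intros)
    moreover have "(\<lambda>t. \<rho> t * (L * (sin (\<theta> t) * cos (\<theta> t)))) integrable_on {0..1}"
      using \<theta>c by (intro integrable_mult continuous_intros)
    ultimately have "(\<lambda>x. L * (sin (\<theta> x) * cos (\<theta> x)) - \<rho> x * (L * (sin (\<theta> x) * cos (\<theta> x)))) integrable_on {0..1}"
      by (rule integrable_diff)
    then show ?thesis by (simp add: p_def[abs_def] algebra_simps)
  qed
  have p_bd: "\<bar>p x\<bar> \<le> L * K" if "x \<in> {0..1}" for x
  proof -
    have "\<bar>p x\<bar> = L * (\<bar>\<rho> x - 1\<bar> * (\<bar>sin (\<theta> x)\<bar> * \<bar>cos (\<theta> x)\<bar>))"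
      using L by (simp add: p_def abs_mult abs_minus_commute)
    also have "\<dots> \<le> L * (K * (1 * 1))"
      using rho1[OF that] L K by (intro mult_left_mono mult_mono) auto
    finally show ?thesis by simp
  qed
  define q where "q x = integral {0..x} p" for x
  have LK: "L * K \<ge> 0" using L K by simp
  have q: "lipschitz_primitive 0 1 q p"
    unfolding q_def[abs_def] by (rule lipschitz_primitive_indefinite_integral[OF p_int p_bd LK])
  have q_bd: "\<bar>q x\<bar> \<le> L * K" if "x \<in> {0..1}" for x
  proof -
    have "(p has_integral q x) {0..x}"
      using lipschitz_primitive_has_integral[OF q, of 0 x] that by (simp add: q_def)
    from has_integral_bound_real[OF LK finite.emptyI this] p_bd that
    have "\<bar>q x\<bar> \<le> L * K * x" by auto
    also have "\<dots> \<le> L * K" using that LK by (auto simp: mult_left_le)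
    finally show ?thesis .
  qed
  show ?thesis
    using that[OF \<theta> q[unfolded p_def[abs_def]] q_bd] .
qed

text \<open>The phase is \<open>\<theta>\<close> and the amplitude \<open>exp q\<close>; the amplitude stays between
  \<open>exp (- L K)\<close> and \<open>exp (L K)\<close>, the phase increases at a rate between \<open>L / K\<close> and \<open>L K\<close>.\<close>

lemma string_equation_pruefer:
  assumes \<theta>: "lipschitz_primitive 0 1 \<theta> (\<lambda>x. L * ((cos (\<theta> x))\<^sup>2 + \<rho> x * (sin (\<theta> x))\<^sup>2))"
    and q: "lipschitz_primitive 0 1 q (\<lambda>x. L * ((1 - \<rho> x) * (sin (\<theta> x) * cos (\<theta> x))))"
  shows "string_equation \<rho> (\<lambda>x. exp (q x) * sin (\<theta> x)) (\<lambda>x. L * (exp (q x) * cos (\<theta> x)))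
    (\<lambda>x. L\<^sup>2 * (exp (q x) * sin (\<theta> x)))"
proof -
  let ?S = "\<lambda>x. exp (q x) * sin (\<theta> x)" and ?V = "\<lambda>x. L * (exp (q x) * cos (\<theta> x))"
  have sc: "sin y * sin y + cos y * cos y = 1" for y :: real
    by (metis power2_eq_square sin_cos_squared_add)
  have e: "lipschitz_primitive 0 1 (\<lambda>x. exp (q x)) (\<lambda>x. exp (q x) * (L * ((1 - \<rho> x) * (sin (\<theta> x) * cos (\<theta> x)))))"
    by (rule lipschitz_primitive_compose[OF q]) (auto intro!: DERIV_exp continuous_intros)
  have s: "lipschitz_primitive 0 1 (\<lambda>x. sin (\<theta> x)) (\<lambda>x. cos (\<theta> x) * (L * ((cos (\<theta> x))\<^sup>2 + \<rho> x * (sin (\<theta> x))\<^sup>2)))"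
    by (rule lipschitz_primitive_compose[OF \<theta>]) (auto intro!: DERIV_sin continuous_intros)
  have c: "lipschitz_primitive 0 1 (\<lambda>x. cos (\<theta> x)) (\<lambda>x. - sin (\<theta> x) * (L * ((cos (\<theta> x))\<^sup>2 + \<rho> x * (sin (\<theta> x))\<^sup>2)))"
    by (rule lipschitz_primitive_compose[OF \<theta>]) (auto intro!: DERIV_cos continuous_intros)
  have S': "?V x = exp (q x) * (L * ((1 - \<rho> x) * (sin (\<theta> x) * cos (\<theta> x)))) * sin (\<theta> x)
      + exp (q x) * (cos (\<theta> x) * (L * ((cos (\<theta> x))\<^sup>2 + \<rho> x * (sin (\<theta> x))\<^sup>2)))" for x
  proof -
    \<comment> \<open>Inserting sin^2 + cos^2 = 1 makes both sides cubic in sine and cosine, so that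
      a polynomial identity remains.\<close>
    have "?V x = ?V x * (sin (\<theta> x) * sin (\<theta> x) + cos (\<theta> x) * cos (\<theta> x))" by (simp only: sc mult_1_right)
    also have "\<dots> = exp (q x) * (L * ((1 - \<rho> x) * (sin (\<theta> x) * cos (\<theta> x)))) * sin (\<theta> x)
      + exp (q x) * (cos (\<theta> x) * (L * ((cos (\<theta> x))\<^sup>2 + \<rho> x * (sin (\<theta> x))\<^sup>2)))"
      by (simp add: algebra_simps power2_eq_square del: sin_cos_squared_add3)
    finally show ?thesis .
  qed
  have V': "- (\<rho> x * (L\<^sup>2 * ?S x)) = L * (exp (q x) * (L * ((1 - \<rho> x) * (sin (\<theta> x) * cos (\<theta> x)))) * cos (\<theta> x)
      + exp (q x) * (- sin (\<theta> x) * (L * ((cos (\<theta> x))\<^sup>2 + \<rho> x * (sin (\<theta> x))\<^sup>2))))" for x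
  proof -
    have "- (\<rho> x * (L\<^sup>2 * ?S x)) = - (\<rho> x * (L\<^sup>2 * ?S x)) * (sin (\<theta> x) * sin (\<theta> x) + cos (\<theta> x) * cos (\<theta> x))"
      by (simp only: sc mult_1_right)
    also have "\<dots> = L * (exp (q x) * (L * ((1 - \<rho> x) * (sin (\<theta> x) * cos (\<theta> x)))) * cos (\<theta> x)
      + exp (q x) * (- sin (\<theta> x) * (L * ((cos (\<theta> x))\<^sup>2 + \<rho> x * (sin (\<theta> x))\<^sup>2))))"
      by (simp add: algebra_simps power2_eq_square del: sin_cos_squared_add3)
    finally show ?thesis .
  qed
  have "lipschitz_primitive 0 1 ?S ?V"
    using lipschitz_primitive_mult[OF e s] unfolding S' .
  moreover have V: "lipschitz_primitive 0 1 ?V (\<lambda>x. - (\<rho> x * (L\<^sup>2 * ?S x)))"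
    using lipschitz_primitive_cmult[OF lipschitz_primitive_mult[OF e c], of L] unfolding V' .
  ultimately show ?thesis
    using lipschitz_primitive_continuous_deriv[OF _ lipschitz_primitive_continuous_on[OF V]]
    unfolding string_equation_def by blast
qed

end

section \<open>Interlacing zeros\<close>

lemma string_equation_rolle:
  assumes "string_equation \<rho> u v w" "x \<in> {0..1}" "y \<in> {0..1}" "x < y" "u x = u y"
  shows "\<exists>t. x < t \<and> t < y \<and> v t = 0"
proof -
  have "(u has_derivative (\<lambda>h. v t * h)) (at t within {x..y})" if "x \<le> t" "t \<le> y" for t
  proof -
    have "{x..y} \<subseteq> {0..1}" "t \<in> {0..1}" using assms(2,3) that by auto
    then show ?thesis
      using assms(1) DERIV_subset[of u "v t" t "{0..1}" "{x..y}"]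
      by (simp add: string_equation_def has_field_derivative_def)
  qed
  from mvt_simple[OF assms(4) this] assms(4,5) show ?thesis by auto
qed

lemma exists_zero_between:
  fixes g :: "real \<Rightarrow> real"
  assumes "continuous_on {x..y} g" "x < y" "g x * g y < 0"
  shows "\<exists>t. x < t \<and> t < y \<and> g t = 0"
proof -
  have "\<exists>t. x \<le> t \<and> t \<le> y \<and> g t = 0"
    using IVT'[of g x 0 y] IVT2'[of g y 0 x] assms by (auto simp: mult_less_0_iff)
  moreover have "g x \<noteq> 0" "g y \<noteq> 0" using assms by auto
  ultimately show ?thesis by (metis order_le_less)
qed

text \<open>Normalised by the factorial so that each integration raises \<open>m\<close> by one and
  keeps the constant \<open>c\<close>.\<close>

lemma lipschitz_primitive_power:
  "lipschitz_primitive a b (\<lambda>x. c * (x - p) ^ Suc m / fact (Suc m)) (\<lambda>x. c * (x - p) ^ m / fact m)"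
proof (rule lipschitz_primitive_of_continuous_deriv)
  show "continuous_on {a..b} (\<lambda>x. c * (x - p) ^ m / fact m)" by (intro continuous_intros) auto
  fix x
  have "((\<lambda>x. (x - p) ^ Suc m) has_real_derivative real (Suc m) * (1 * (x - p) ^ (Suc m - Suc 0))) (at x within {a..b})"
    by (intro DERIV_power) (auto intro!: derivative_eq_intros)
  from DERIV_cdivide[OF DERIV_cmult[OF this, of c], of "fact (Suc m)"]
  show "((\<lambda>x. c * (x - p) ^ Suc m / fact (Suc m)) has_real_derivative c * (x - p) ^ m / fact m) (at x within {a..b})"
    by (simp add: field_simps del: of_nat_Suc power_Suc)
qed

context bounded_density
begin

text \<open>The sign of v' is known only almost everywhere, which by itself gives weak monotonicity.
  Strictness comes from the middle third of the interval, where \<open>w\<close> has a positive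
  minimum \<open>c\<close> and v' is at most - c / K.\<close>

lemma string_equation_strict_decreasing:
  assumes "string_equation \<rho> u v w" "continuous_on {0..1} w" "x \<in> {0..1}" "y \<in> {0..1}" "x < y"
    and w: "\<And>t. x < t \<Longrightarrow> t < y \<Longrightarrow> w t > 0"
  shows "v y < v x"
proof -
  define x' y' where "x' = (2 * x + y) / 3" and "y' = (x + 2 * y) / 3"
  have xy: "x < x'" "x' < y'" "y' < y" using assms(5) by (auto simp: x'_def y'_def)
  have v: "lipschitz_primitive 0 1 v (\<lambda>x. - (\<rho> x * w x))"
    using assms(1) by (simp add: string_equation_def)
  have sub: "{x..y} \<subseteq> {0..1}" using assms by auto
  have w0: "w t \<ge> 0" if "t \<in> {x..y}" for t
  proof -
    have "continuous_on {x..y} w" using continuous_on_subset[OF assms(2) sub] .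
    moreover have "closure {x<..<y} = {x..y}" using assms(5) by simp
    ultimately show ?thesis
      using continuous_ge_on_closure[of "{x<..<y}" w t 0] that w by (auto simp: less_imp_le)
  qed
  have mono: "v d - v c \<le> 0" if "x \<le> c" "c \<le> d" "d \<le> y" for c d
    using lipschitz_primitive_le[OF v lipschitz_primitive_const[of 0 1 0], of c d] that sub w0 pos
    by (force intro!: mult_nonneg_nonneg simp: less_imp_le)
  obtain c where c: "c > 0" "\<And>t. t \<in> {x'..y'} \<Longrightarrow> c \<le> w t"
  proof -
    have "continuous_on {x'..y'} w"
      by (rule continuous_on_subset[OF assms(2)]) (use xy sub in auto)
    then obtain m where "m \<in> {x'..y'}" "\<And>t. t \<in> {x'..y'} \<Longrightarrow> w m \<le> w t"
      using continuous_attains_inf[of "{x'..y'}" w] xy by auto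
    then show ?thesis using that[of "w m"] w xy by auto
  qed
  have "lipschitz_primitive 0 1 (\<lambda>t. - (c / K) * (t - 0) ^ Suc 0 / fact (Suc 0)) (\<lambda>t. - (c / K) * (t - 0) ^ 0 / fact 0)"
    by (rule lipschitz_primitive_power)
  then have lin: "lipschitz_primitive 0 1 (\<lambda>t. - (c / K) * t) (\<lambda>t. - (c / K))" by simp
  have "v y' - v x' \<le> - (c / K) * y' - - (c / K) * x'"
  proof (rule lipschitz_primitive_le[OF v lin])
    fix t assume t: "t \<in> {x'..y'}"
    then have "t \<in> {0..1}" using sub xy by auto
    then have "(1 / K) * c \<le> \<rho> t * w t"
      using lower c t pos by (intro mult_mono) (auto simp: less_imp_le)
    then show "- (\<rho> t * w t) \<le> - (c / K)" by simp
  qed (use xy sub in auto)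
  also have "\<dots> = - ((c / K) * (y' - x'))" using K_pos by (simp add: field_simps)
  also have "\<dots> < 0" using c K_pos xy by simp
  finally show ?thesis using mono[of x x'] mono[of y' y] xy by simp
qed

text \<open>The classical Rolle theorem fails for \<open>v\<close>, which need not be differentiable
  everywhere. Instead, a continuous \<open>w\<close> without zeros has constant sign, and then
  \<open>v\<close> is strictly monotone. Positivity of the density is what turns a sign of \<rho> w
  into a sign of \<open>w\<close>.\<close>

lemma string_equation_rolle_deriv:
  assumes eq: "string_equation \<rho> u v w" and w: "continuous_on {0..1} w"
    and xy: "x \<in> {0..1}" "y \<in> {0..1}" "x < y" and v: "v x = v y"
  shows "\<exists>t. x < t \<and> t < y \<and> w t = 0"
proof (rule ccontr)
  assume neg: "\<not> ?thesis"
  define m where "m = (x + y) / 2"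
  have m: "x < m" "m < y" using xy by (auto simp: m_def)
  have sgn: "w t * w m > 0" if "x < t" "t < y" for t
  proof (rule ccontr)
    assume "\<not> w t * w m > 0"
    moreover have "w t * w m \<noteq> 0" using neg that m by auto
    ultimately have neg': "w t * w m < 0" by linarith
    then have "t \<noteq> m" by auto
    have "continuous_on {min t m..max t m} w"
      by (rule continuous_on_subset[OF w]) (use xy that m in auto)
    then have "\<exists>s. min t m < s \<and> s < max t m \<and> w s = 0"
      by (rule exists_zero_between) (use \<open>t \<noteq> m\<close> neg' in \<open>auto simp: min_def max_def mult.commute\<close>)
    then show False using neg that m by auto
  qed
  have "w m \<noteq> 0" using neg m by blast
  then consider "w m > 0" | "w m < 0" by linarith
  then show False
  proof cases
    case 1
    then have "v y < v x"
      using sgn by (intro string_equation_strict_decreasing[OF eq w xy]) (auto simp: zero_less_mult_iff)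
    then show False using v by simp
  next
    case 2
    have "-1 * v y < -1 * v x"
      using sgn 2 w by (intro string_equation_strict_decreasing[OF string_equation_cmult[OF eq, of "-1"] _ xy])
        (auto simp: zero_less_mult_iff intro: continuous_intros)
    then show False using v by simp
  qed
qed

text \<open>The last zero moves to the left from each derivative to the next, so the iterated integral
  runs over a simplex, whence the factorial.\<close>

lemma string_chain_remainder:
  assumes "\<And>j. j < n \<Longrightarrow> string_equation \<rho> (g j) (v j) (g (Suc j))"
    and "continuous_on {0..1} (g n)"
    and "\<And>i. i \<le> 2 * n \<Longrightarrow> z i \<in> {0..1} \<and> g 0 (z i) = 0"
    and "\<And>i. i < 2 * n \<Longrightarrow> z i < z (Suc i)"
    and "\<And>x. x \<in> {0..1} \<Longrightarrow> \<bar>g n x\<bar> \<le> M"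
    and "x \<in> {z (2 * n)..1}"
  shows "\<bar>g 0 x\<bar> \<le> K ^ n * M * x ^ (2 * n) / fact (2 * n)"
  using assms
proof (induction n arbitrary: g v z x)
  case 0
  then show ?case by auto
next
  case (Suc n)
  note eq0 = Suc.prems(1)[of 0, simplified]
  have g1c: "continuous_on {0..1} (g 1)"
  proof (cases "n = 0")
    case True then show ?thesis using Suc.prems(2) by simp
  next
    case False
    then have "1 < Suc n" by simp
    from string_equation_continuous[OF Suc.prems(1)[OF this]] show ?thesis .
  qed
  have M: "M \<ge> 0" using Suc.prems(5)[of 0] abs_ge_zero[of "g (Suc n) 0"] by (simp del: abs_ge_zero)
  \<comment> \<open>The indices count down: 2n+3 zeros of \<open>g 0\<close> give 2n+2 zeros of
    \<open>v 0\<close> and then 2n+1 zeros of \<open>g 1\<close>, exactly the number that the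
    induction hypothesis needs.\<close>
  have "\<exists>t. z i < t \<and> t < z (Suc i) \<and> v 0 t = 0" if "i \<le> 2 * n + 1" for i
    by (rule string_equation_rolle[OF eq0]) (use that Suc.prems(3)[of i] Suc.prems(3)[of "Suc i"] Suc.prems(4)[of i] in auto)
  then obtain z1 where z1: "\<And>i. i \<le> 2 * n + 1 \<Longrightarrow> z i < z1 i \<and> z1 i < z (Suc i) \<and> v 0 (z1 i) = 0"
    by metis
  have z1_in: "z1 i \<in> {0..1}" if "i \<le> 2 * n + 1" for i
    using z1[OF that] Suc.prems(3)[of i] Suc.prems(3)[of "Suc i"] that by auto
  have z1_less: "z1 i < z1 (Suc i)" if "i \<le> 2 * n" for i
    using z1[of i] z1[of "Suc i"] that by auto
  have "\<forall>i. \<exists>t. i \<le> 2 * n \<longrightarrow> z1 i < t \<and> t < z1 (Suc i) \<and> g 1 t = 0"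
  proof (intro allI)
    fix i
    show "\<exists>t. i \<le> 2 * n \<longrightarrow> z1 i < t \<and> t < z1 (Suc i) \<and> g 1 t = 0"
    proof (cases "i \<le> 2 * n")
      case True
      then have "v 0 (z1 i) = v 0 (z1 (Suc i))" using z1[of i] z1[of "Suc i"] by simp
      from string_equation_rolle_deriv[OF eq0 _ z1_in z1_in z1_less[OF True] this] g1c True
      show ?thesis by auto
    qed auto
  qed
  then obtain z2 where z2: "\<And>i. i \<le> 2 * n \<Longrightarrow> z1 i < z2 i \<and> z2 i < z1 (Suc i) \<and> g 1 (z2 i) = 0"
    by metis
  have IH: "\<bar>g 1 x\<bar> \<le> K ^ n * M * x ^ (2 * n) / fact (2 * n)" if "x \<in> {z2 (2 * n)..1}" for x
  proof -
    have "\<bar>(\<lambda>j. g (Suc j)) 0 x\<bar> \<le> K ^ n * M * x ^ (2 * n) / fact (2 * n)"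
    proof (rule Suc.IH[where v="\<lambda>j. v (Suc j)" and z=z2])
      show "string_equation \<rho> (g (Suc j)) (v (Suc j)) (g (Suc (Suc j)))" if "j < n" for j
        using Suc.prems(1)[of "Suc j"] that by simp
      show "continuous_on {0..1} (g (Suc n))" by (rule Suc.prems(2))
      show "z2 i \<in> {0..1} \<and> g (Suc 0) (z2 i) = 0" if "i \<le> 2 * n" for i
        using z2[OF that] z1_in[of i] z1_in[of "Suc i"] that by auto
      show "z2 i < z2 (Suc i)" if "i < 2 * n" for i
        using z2[of i] z2[of "Suc i"] that by auto
      show "\<bar>g (Suc n) x\<bar> \<le> M" if "x \<in> {0..1}" for x using Suc.prems(5)[OF that] .
      show "x \<in> {z2 (2 * n)..1}" by fact
    qed
    then show ?thesis by simp
  qed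
  let ?c = "K ^ Suc n * M"
  \<comment> \<open>The last zero of \<open>v 0\<close>. It lies to the right of the last chosen
    zero of \<open>g 1\<close>, so the bound for \<open>g 1\<close> is valid on all of
    \<open>{s..1}\<close>.\<close>
  define s where "s = z1 (2 * n + 1)"
  have s: "v 0 s = 0" "z2 (2 * n) < s" "s < z (2 * Suc n)" "s \<in> {0..1}"
    using z1[of "2 * n + 1"] z2[of "2 * n"] z1_in[of "2 * n + 1"] by (auto simp: s_def)
  have V: "\<bar>v 0 x\<bar> \<le> ?c * x ^ Suc (2 * n) / fact (Suc (2 * n))" if x: "x \<in> {s..1}" for x
  proof -
    have lv: "lipschitz_primitive 0 1 (v 0) (\<lambda>x. - (\<rho> x * g 1 x))"
      using eq0 by (simp add: string_equation_def)
    \<comment> \<open>Powers of the distance to 0 rather than to \<open>s\<close> serve as majorants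
      at every level; the boundary term at \<open>s\<close> enters with a favourable sign and is
      dropped.\<close>
    have "\<bar>v 0 x - v 0 s\<bar> \<le> ?c * (x - 0) ^ Suc (2 * n) / fact (Suc (2 * n)) - ?c * (s - 0) ^ Suc (2 * n) / fact (Suc (2 * n))"
    proof (rule lipschitz_primitive_abs_le[OF lv lipschitz_primitive_power])
      fix t assume t: "t \<in> {s..x}"
      then have t01: "t \<in> {0..1}" and "t \<in> {z2 (2 * n)..1}" using s x by auto
      then have "\<bar>\<rho> t\<bar> * \<bar>g 1 t\<bar> \<le> K * (K ^ n * M * t ^ (2 * n) / fact (2 * n))"
        using pos[OF t01] upper[OF t01] IH K by (intro mult_mono) auto
      then show "\<bar>- (\<rho> t * g 1 t)\<bar> \<le> ?c * (t - 0) ^ (2 * n) / fact (2 * n)"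
        by (simp add: abs_mult mult_ac)
    qed (use s x in auto)
    also have "\<dots> \<le> ?c * x ^ Suc (2 * n) / fact (Suc (2 * n))"
      using K M s(4) by simp
    finally show ?thesis using s(1) by simp
  qed
  define r where "r = z (2 * Suc n)"
  have r: "g 0 r = 0" "s < r" "r \<in> {0..1}" using Suc.prems(3)[of "2 * Suc n"] s by (auto simp: r_def)
  have x: "x \<in> {r..1}" using Suc.prems(6) by (simp add: r_def)
  have "\<bar>g 0 x - g 0 r\<bar> \<le> ?c * (x - 0) ^ Suc (Suc (2 * n)) / fact (Suc (Suc (2 * n)))
      - ?c * (r - 0) ^ Suc (Suc (2 * n)) / fact (Suc (Suc (2 * n)))"
    by (rule lipschitz_primitive_abs_le[OF string_equation_lipschitz_primitive[OF eq0] lipschitz_primitive_power])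
       (use r x V in auto)
  also have "\<dots> \<le> ?c * x ^ Suc (Suc (2 * n)) / fact (Suc (Suc (2 * n)))"
    using K M r(3) by simp
  finally show ?case using r(1) by simp
qed

text \<open>The comparison yields sign alternations rather than zeros; 2n+2 of them give 2n+1 zeros
  by the intermediate value theorem, and the power of \<open>x\<close> in the remainder is at most
  1.\<close>

lemma alternating_chain_remainder:
  assumes eq: "\<And>j. j < n \<Longrightarrow> string_equation \<rho> (g j) (v j) (g (Suc j))"
    and gn: "continuous_on {0..1} (g n)" and g0: "continuous_on {0..1} (g 0)"
    and y: "\<And>i. i \<le> 2 * n + 1 \<Longrightarrow> y i \<in> {0..1} \<and> (-1) ^ i * g 0 (y i) < 0"
    and y_less: "\<And>i. i \<le> 2 * n \<Longrightarrow> y i < y (Suc i)"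
    and M: "\<And>x. x \<in> {0..1} \<Longrightarrow> \<bar>g n x\<bar> \<le> M"
    and x: "x \<in> {y (2 * n + 1)..1}"
  shows "\<bar>g 0 x\<bar> \<le> K ^ n * M / fact (2 * n)"
proof -
  have "\<exists>t. y i < t \<and> t < y (Suc i) \<and> g 0 t = 0" if i: "i \<le> 2 * n" for i
  proof (rule exists_zero_between[OF _ y_less[OF i]])
    show "continuous_on {y i..y (Suc i)} (g 0)"
      by (rule continuous_on_subset[OF g0]) (use y[of i] y[of "Suc i"] i in auto)
    have "((-1) ^ i * g 0 (y i)) * ((-1) ^ Suc i * g 0 (y (Suc i))) > 0"
      using y[of i] y[of "Suc i"] i by (intro mult_neg_neg) auto
    then show "g 0 (y i) * g 0 (y (Suc i)) < 0"
      by (cases "even i") (auto simp: mult_ac)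
  qed
  then obtain z where z: "\<And>i. i \<le> 2 * n \<Longrightarrow> y i < z i \<and> z i < y (Suc i) \<and> g 0 (z i) = 0"
    by metis
  have z01: "z i \<in> {0..1}" if "i \<le> 2 * n" for i
    using z[OF that] y[of i] y[of "Suc i"] that by auto
  have xz: "x \<in> {z (2 * n)..1}" using x z[of "2 * n"] by auto
  then have x01: "x \<in> {0..1}" using z01[of "2 * n"] by auto
  have "\<bar>g 0 x\<bar> \<le> K ^ n * M * x ^ (2 * n) / fact (2 * n)"
  proof (rule string_chain_remainder[where z=z and v=v, OF eq gn _ _ M xz])
    show "z i \<in> {0..1} \<and> g 0 (z i) = 0" if "i \<le> 2 * n" for i
      using z01[OF that] z[OF that] by simp
    show "z i < z (Suc i)" if "i < 2 * n" for i
      using z[of i] z[of "Suc i"] that by auto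
  qed
  also have "\<dots> \<le> K ^ n * M * 1 / fact (2 * n)"
    using x01 K M[of 0] by (intro divide_right_mono mult_left_mono power_le_one) auto
  finally show ?thesis by simp
qed

end

section \<open>Comparison with an oscillating solution\<close>

lemma sin_ge_half:
  assumes "pi / 6 \<le> x" "x \<le> 5 * pi / 6"
  shows "1 / 2 \<le> sin x"
proof (cases "x \<le> pi / 2")
  case True
  then have "sin (pi / 6) \<le> sin x" using assms by (intro sin_monotone_2pi_le) auto
  then show ?thesis by (simp add: sin_30)
next
  case False
  then have "sin (pi / 6) \<le> sin (pi - x)" using assms by (intro sin_monotone_2pi_le) auto
  then show ?thesis by (simp add: sin_30)
qed

context bounded_density
begin

text \<open>In Pruefer coordinates the sine is at least 1/2 where the phase, modulo a multiple of
  \<pi>, lies between \<pi>/6 and 5\<pi>/6; \<open>p i\<close> and \<open>r i\<close> are the points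
  where these phases are attained in the i-th half-wave. A phase speed of at least L/K produces
  enough half-waves, a speed of at most L K keeps them from being too short, and the amplitude is
  bounded below by e^(-LK).\<close>

lemma oscillating_solution:
  fixes m :: nat
  assumes L: "L > 0" and ab: "0 \<le> \<alpha>" "\<alpha> < \<beta>" "\<beta> \<le> 1"
    and osc: "K * ((real m + 2) * pi) \<le> L * (\<beta> - \<alpha>)"
  obtains S V p r where "string_equation \<rho> S V (\<lambda>x. L\<^sup>2 * S x)"
    "\<And>x. x \<in> {0..1} \<Longrightarrow> \<bar>S x\<bar> \<le> exp (L * K)"
    "\<And>i. i \<le> m \<Longrightarrow> \<alpha> \<le> p i \<and> p i < r i \<and> r i \<le> \<beta>"
    "\<And>i. i < m \<Longrightarrow> r i < p (Suc i)"
    "\<And>i. i \<le> m \<Longrightarrow> 2 \<le> L * K * (r i - p i)"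
    "\<And>i x. i \<le> m \<Longrightarrow> x \<in> {p i..r i} \<Longrightarrow> exp (- (L * K)) / 2 \<le> (-1) ^ i * S x"
proof -
  obtain \<theta> q where
    \<theta>: "lipschitz_primitive 0 1 \<theta> (\<lambda>x. L * ((cos (\<theta> x))\<^sup>2 + \<rho> x * (sin (\<theta> x))\<^sup>2))" and
    q: "lipschitz_primitive 0 1 q (\<lambda>x. L * ((1 - \<rho> x) * (sin (\<theta> x) * cos (\<theta> x))))" and
    q_bd: "\<And>x. x \<in> {0..1} \<Longrightarrow> \<bar>q x\<bar> \<le> L * K"
    by (rule pruefer_existence[OF L]) (rule that, assumption, assumption, blast)
  have lin: "lipschitz_primitive 0 1 (\<lambda>x. c * x) (\<lambda>x. c)" for c
    using lipschitz_primitive_power[of 0 1 c 0 0] by simp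
  have \<theta>_lower: "L / K * (y - x) \<le> \<theta> y - \<theta> x" if "0 \<le> x" "x \<le> y" "y \<le> 1" for x y
  proof -
    have "L / K * y - L / K * x \<le> \<theta> y - \<theta> x"
    proof (rule lipschitz_primitive_le[OF lin \<theta> that])
      fix t assume "t \<in> {x..y}"
      then have t: "t \<in> {0..1}" using that by auto
      have "1 / K * (cos (\<theta> t))\<^sup>2 + 1 / K * (sin (\<theta> t))\<^sup>2 \<le> (cos (\<theta> t))\<^sup>2 + \<rho> t * (sin (\<theta> t))\<^sup>2"
        using lower[OF t] K mult_right_mono[of "1 / K" 1 "(cos (\<theta> t))\<^sup>2"]
        by (intro add_mono mult_right_mono) auto
      then have "1 / K \<le> (cos (\<theta> t))\<^sup>2 + \<rho> t * (sin (\<theta> t))\<^sup>2"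
        by (simp flip: distrib_left add_divide_distrib)
      then have "L * (1 / K) \<le> L * ((cos (\<theta> t))\<^sup>2 + \<rho> t * (sin (\<theta> t))\<^sup>2)"
        using L by (intro mult_left_mono) auto
      then show "L / K \<le> L * ((cos (\<theta> t))\<^sup>2 + \<rho> t * (sin (\<theta> t))\<^sup>2)" by simp
    qed
    then show ?thesis by (simp add: right_diff_distrib)
  qed
  have \<theta>_upper: "\<theta> y - \<theta> x \<le> L * K * (y - x)" if "0 \<le> x" "x \<le> y" "y \<le> 1" for x y
  proof -
    have "\<theta> y - \<theta> x \<le> L * K * y - L * K * x"
    proof (rule lipschitz_primitive_le[OF \<theta> lin that])
      fix t assume "t \<in> {x..y}"
      then have t: "t \<in> {0..1}" using that by auto
      have "(cos (\<theta> t))\<^sup>2 + \<rho> t * (sin (\<theta> t))\<^sup>2 \<le> K * (cos (\<theta> t))\<^sup>2 + K * (sin (\<theta> t))\<^sup>2"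
        using upper[OF t] K by (intro add_mono mult_right_mono) (auto simp: mult_le_cancel_right1)
      also have "\<dots> = K" by (simp flip: distrib_left)
      finally show "L * ((cos (\<theta> t))\<^sup>2 + \<rho> t * (sin (\<theta> t))\<^sup>2) \<le> L * K"
        using L by (intro mult_left_mono) auto
    qed
    then show ?thesis by (simp add: right_diff_distrib)
  qed
  have \<theta>_mono: "\<theta> x \<le> \<theta> y" if "0 \<le> x" "x \<le> y" "y \<le> 1" for x y
  proof -
    have "0 \<le> L / K * (y - x)" using L K_pos that by simp
    then show ?thesis using \<theta>_lower[OF that] by linarith
  qed
  \<comment> \<open>The first multiple of \<pi> not below the initial phase. Rounding up wastes less
    than \<pi>, and the half-waves 0 to m take (m+1) \<pi>; together this is the m + 2 in the
    hypothesis.\<close>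
  define k where "k = \<lceil>\<theta> \<alpha> / pi\<rceil>"
  have k: "\<theta> \<alpha> \<le> of_int k * pi" "of_int k * pi < \<theta> \<alpha> + pi"
  proof -
    have "\<theta> \<alpha> / pi \<le> of_int k" "of_int k < \<theta> \<alpha> / pi + 1" unfolding k_def by linarith+
    then show "\<theta> \<alpha> \<le> of_int k * pi" "of_int k * pi < \<theta> \<alpha> + pi" by (auto simp: field_simps)
  qed
  have range: "\<theta> \<alpha> + (real m + 2) * pi \<le> \<theta> \<beta>"
  proof -
    have "(real m + 2) * pi \<le> L / K * (\<beta> - \<alpha>)" using osc K_pos by (simp add: field_simps)
    then show ?thesis using \<theta>_lower[of \<alpha> \<beta>] ab by simp
  qed
  have level: "\<exists>x. x \<in> {\<alpha>..\<beta>} \<and> \<theta> x = of_int k * pi + real i * pi + c"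
    if i: "i \<le> m" and c: "0 \<le> c" "c \<le> pi" for i c
  proof -
    have "real i * pi \<le> real m * pi" using i by simp
    moreover have "0 \<le> real i * pi" by simp
    ultimately have "\<theta> \<alpha> \<le> of_int k * pi + real i * pi + c" "of_int k * pi + real i * pi + c \<le> \<theta> \<beta>"
      using k c range by (simp_all only: distrib_right)
    moreover have "continuous_on {\<alpha>..\<beta>} \<theta>"
      by (rule continuous_on_subset[OF lipschitz_primitive_continuous_on[OF \<theta>]]) (use ab in auto)
    ultimately show ?thesis using IVT'[of \<theta> \<alpha> _ \<beta>] ab by auto
  qed
  have "\<exists>x. x \<in> {\<alpha>..\<beta>} \<and> \<theta> x = of_int k * pi + real i * pi + pi / 6" if "i \<le> m" for i
    using level[OF that, of "pi / 6"] by simp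
  then obtain p where p: "\<And>i. i \<le> m \<Longrightarrow> p i \<in> {\<alpha>..\<beta>}"
    "\<And>i. i \<le> m \<Longrightarrow> \<theta> (p i) = of_int k * pi + real i * pi + pi / 6" by metis
  have "\<exists>x. x \<in> {\<alpha>..\<beta>} \<and> \<theta> x = of_int k * pi + real i * pi + 5 * pi / 6" if "i \<le> m" for i
    using level[OF that, of "5 * pi / 6"] by simp
  then obtain r where r: "\<And>i. i \<le> m \<Longrightarrow> r i \<in> {\<alpha>..\<beta>}"
    "\<And>i. i \<le> m \<Longrightarrow> \<theta> (r i) = of_int k * pi + real i * pi + 5 * pi / 6" by metis
  have less: "x < y" if "\<theta> x < \<theta> y" "x \<in> {\<alpha>..\<beta>}" "y \<in> {\<alpha>..\<beta>}" for x y
    using \<theta>_mono[of y x] that ab by (force simp: not_le)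
  have sin_k: "sin (of_int k * pi) = 0" using sin_npi_int[of k] by (simp add: mult.commute)
  \<comment> \<open>A sign that makes \<open>S\<close> positive on the half-wave with index 0,
    whatever the parity of \<open>k\<close>.\<close>
  define \<sigma> where "\<sigma> = cos (of_int k * pi)"
  have \<sigma>: "\<sigma> * \<sigma> = 1" "\<bar>\<sigma>\<bar> = 1"
    unfolding \<sigma>_def using cos_npi_int[of k] by (cases "even k"; simp add: mult.commute)+
  define S where "S x = \<sigma> * (exp (q x) * sin (\<theta> x))" for x
  show ?thesis
  proof (rule that[of S "\<lambda>x. \<sigma> * (L * (exp (q x) * cos (\<theta> x)))" p r])
    show "string_equation \<rho> S (\<lambda>x. \<sigma> * (L * (exp (q x) * cos (\<theta> x)))) (\<lambda>x. L\<^sup>2 * S x)"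
      using string_equation_cmult[OF string_equation_pruefer[OF \<theta> q], of \<sigma>]
      by (simp add: S_def[abs_def] mult.left_commute)
    show "\<bar>S x\<bar> \<le> exp (L * K)" if "x \<in> {0..1}" for x
    proof -
      have "\<bar>S x\<bar> = exp (q x) * \<bar>sin (\<theta> x)\<bar>" by (simp add: S_def abs_mult \<sigma>)
      also have "\<dots> \<le> exp (L * K) * 1" using q_bd[OF that] by (intro mult_mono) auto
      finally show ?thesis by simp
    qed
    show "\<alpha> \<le> p i \<and> p i < r i \<and> r i \<le> \<beta>" if "i \<le> m" for i
      using p[OF that] r[OF that] less[of "p i" "r i"] by auto
    show "r i < p (Suc i)" if "i < m" for i
    proof (rule less)
      show "\<theta> (r i) < \<theta> (p (Suc i))" using that p(2)[of "Suc i"] r(2)[of i] by (simp add: algebra_simps)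
    qed (use that p r in auto)
    show "2 \<le> L * K * (r i - p i)" if i: "i \<le> m" for i
    proof -
      \<comment> \<open>Between \<open>p i\<close> and \<open>r i\<close> the phase gains 2\<pi>/3,
        which is more than 2, at a speed of at most L K.\<close>
      have "2 \<le> 2 * pi / 3" using pi_gt3 by simp
      also have "\<dots> = \<theta> (r i) - \<theta> (p i)" using p(2)[OF i] r(2)[OF i] by simp
      also have "\<dots> \<le> L * K * (r i - p i)"
        using p[OF i] r[OF i] less[of "p i" "r i"] ab by (intro \<theta>_upper) auto
      finally show ?thesis .
    qed
    show "exp (- (L * K)) / 2 \<le> (-1) ^ i * S x" if i: "i \<le> m" and x: "x \<in> {p i..r i}" for i x
    proof -
      define \<psi> where "\<psi> = \<theta> x - (of_int k * pi + real i * pi)"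
      have x01: "x \<in> {0..1}" using x p(1)[OF i] r(1)[OF i] ab by auto
      have "\<theta> (p i) \<le> \<theta> x" "\<theta> x \<le> \<theta> (r i)"
        using \<theta>_mono[of "p i" x] \<theta>_mono[of x "r i"] x p(1)[OF i] r(1)[OF i] ab by auto
      then have \<psi>: "1 / 2 \<le> sin \<psi>"
        using p(2)[OF i] r(2)[OF i] by (intro sin_ge_half) (auto simp: \<psi>_def)
      have "\<theta> x = of_int k * pi + (real i * pi + \<psi>)" by (simp add: \<psi>_def)
      then have "sin (\<theta> x) = \<sigma> * ((-1) ^ i * sin \<psi>)"
        by (simp only: sin_add[of "of_int k * pi"] sin_add[of "real i * pi"] sin_k sin_npi cos_npi) (simp add: \<sigma>_def)
      then have "(-1) ^ i * S x = (\<sigma> * \<sigma>) * ((-1) ^ i * (-1) ^ i) * (exp (q x) * sin \<psi>)"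
        by (simp add: S_def mult_ac)
      then have eq: "(-1) ^ i * S x = exp (q x) * sin \<psi>" by (simp add: \<sigma> flip: power_mult_distrib)
      have "exp (- (L * K)) * (1 / 2) \<le> exp (q x) * sin \<psi>"
        using q_bd[OF x01] \<psi> by (intro mult_mono) auto
      then show ?thesis using eq by simp
    qed
  qed
qed

text \<open>The comparison function is \<open>B\<close> times \<open>S\<close>. The factor e^(4LK)
  in the condition on \<open>B\<close> makes \<bar>f\<bar> smaller than B e^(-LK) / 2, hence than B
  \<bar>S\<bar>, at some point of every piece \<open>{p i..r i}\<close>. The difference then
  alternates in sign and obeys the remainder bound; adding \<open>B * S\<close> back costs another
  multiple of B e^(2LK).\<close>

lemma right_propagation:
  assumes eq: "\<And>j. j < n \<Longrightarrow> string_equation \<rho> (f j) (f' j) (f (Suc j))"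
    and fn: "continuous_on {0..1} (f n)" and f0: "continuous_on {0..1} (f 0)"
    and M: "\<And>x. x \<in> {0..1} \<Longrightarrow> \<bar>f n x\<bar> \<le> M"
    and ab: "0 \<le> \<alpha>" "\<alpha> < \<beta>" "\<beta> \<le> 1"
    and L: "L > 0" "K * ((2 * real n + 3) * pi) \<le> L * (\<beta> - \<alpha>)"
    and B: "B > 0" "exp (4 * (L * K)) * integral {\<alpha>..\<beta>} (\<lambda>x. (f 0 x)\<^sup>2) < B\<^sup>2"
    and x: "x \<in> {\<beta>..1}"
  shows "\<bar>f 0 x\<bar> \<le> 2 * B * exp (2 * (L * K)) + K ^ n * M / fact (2 * n)"
proof -
  define E where "E = integral {\<alpha>..\<beta>} (\<lambda>x. (f 0 x)\<^sup>2)"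
  \<comment> \<open>Half-waves 0 to 2n+1 are requested, one for each of the 2n+2 alternation
    points.\<close>
  have osc: "K * ((real (2 * n + 1) + 2) * pi) \<le> L * (\<beta> - \<alpha>)" using L(2) by (simp add: add.commute)
  obtain S V p r where S: "string_equation \<rho> S V (\<lambda>x. L\<^sup>2 * S x)"
    and S_bd: "\<And>x. x \<in> {0..1} \<Longrightarrow> \<bar>S x\<bar> \<le> exp (L * K)"
    and pr: "\<And>i. i \<le> 2 * n + 1 \<Longrightarrow> \<alpha> \<le> p i \<and> p i < r i \<and> r i \<le> \<beta>"
    and rp: "\<And>i. i < 2 * n + 1 \<Longrightarrow> r i < p (Suc i)"
    and len: "\<And>i. i \<le> 2 * n + 1 \<Longrightarrow> 2 \<le> L * K * (r i - p i)"
    and S_ge: "\<And>i x. i \<le> 2 * n + 1 \<Longrightarrow> x \<in> {p i..r i} \<Longrightarrow> exp (- (L * K)) / 2 \<le> (-1) ^ i * S x"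
    by (rule oscillating_solution[OF L(1) ab osc]) (rule that, assumption, blast+)
  have LK: "L * K > 0" using L K_pos by simp
  have sub: "{\<alpha>..\<beta>} \<subseteq> {0..1}" using ab by auto
  have sq_int: "(\<lambda>x. (f 0 x)\<^sup>2) integrable_on {c..d}" if "{c..d} \<subseteq> {0..1}" for c d
    by (intro integrable_continuous_real continuous_intros continuous_on_subset[OF f0 that])
  \<comment> \<open>Take \<open>y\<close> where the square of \<open>f 0\<close> is smallest on the
    piece. As the piece has length at least 2/(LK), four times that square is at most 2LK E \<le>
    e^(2LK) E, which is less than e^(-2LK) B^2.\<close>
  have "\<exists>y\<in>{p i..r i}. \<bar>f 0 y\<bar> < B * exp (- (L * K)) / 2" if i: "i \<le> 2 * n + 1" for i
  proof -
    have pi_sub: "{p i..r i} \<subseteq> {\<alpha>..\<beta>}" and pri: "p i < r i" using pr[OF i] by auto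
    have cont: "continuous_on {p i..r i} (\<lambda>x. (f 0 x)\<^sup>2)"
      using pi_sub sub by (intro continuous_intros continuous_on_subset[OF f0]) auto
    then obtain y where y: "y \<in> {p i..r i}" "\<And>t. t \<in> {p i..r i} \<Longrightarrow> (f 0 y)\<^sup>2 \<le> (f 0 t)\<^sup>2"
      using continuous_attains_inf[of "{p i..r i}" "\<lambda>x. (f 0 x)\<^sup>2"] pri by auto
    have "(f 0 y)\<^sup>2 * (r i - p i) = integral {p i..r i} (\<lambda>_. (f 0 y)\<^sup>2)" using pri by simp
    also have "\<dots> \<le> integral {p i..r i} (\<lambda>x. (f 0 x)\<^sup>2)"
      using y(2) pi_sub sub by (intro integral_le sq_int) auto
    also have "\<dots> \<le> E"
      unfolding E_def using pi_sub sub by (intro integral_subset_le sq_int) auto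
    finally have yE: "(f 0 y)\<^sup>2 * (r i - p i) \<le> E" .
    have "(f 0 y)\<^sup>2 * 2 \<le> (f 0 y)\<^sup>2 * (L * K * (r i - p i))"
      using len[OF i] by (intro mult_left_mono) auto
    also have "\<dots> = L * K * ((f 0 y)\<^sup>2 * (r i - p i))" by (simp add: mult_ac)
    also have "\<dots> \<le> L * K * E" using yE LK by (intro mult_left_mono) auto
    finally have "4 * (f 0 y)\<^sup>2 \<le> (2 * (L * K)) * E" by (simp only: mult.assoc)
    also have "\<dots> \<le> exp (2 * (L * K)) * E"
    proof (rule mult_right_mono)
      show "2 * (L * K) \<le> exp (2 * (L * K))" using exp_ge_add_one_self[of "2 * (L * K)"] by linarith
      show "E \<ge> 0" unfolding E_def by (rule integral_nonneg) (use sq_int sub in auto)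
    qed
    also have "\<dots> = exp (- (2 * (L * K))) * (exp (4 * (L * K)) * E)"
      by (simp flip: mult.assoc exp_add)
    also have "\<dots> < exp (- (2 * (L * K))) * B\<^sup>2"
      using B(2) by (intro mult_strict_left_mono) (auto simp: E_def)
    also have "\<dots> = (B * exp (- (L * K)))\<^sup>2"
      by (simp add: power_mult_distrib flip: exp_double)
    finally have "(2 * \<bar>f 0 y\<bar>)\<^sup>2 < (B * exp (- (L * K)))\<^sup>2" by (simp add: power_mult_distrib)
    then have "2 * \<bar>f 0 y\<bar> < B * exp (- (L * K))"
      by (rule power2_less_imp_less) (use B in auto)
    then show ?thesis using y(1) by (intro bexI[of _ y]) auto
  qed
  then obtain y where y: "\<And>i. i \<le> 2 * n + 1 \<Longrightarrow> y i \<in> {p i..r i}"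
     "\<And>i. i \<le> 2 * n + 1 \<Longrightarrow> \<bar>f 0 (y i)\<bar> < B * exp (- (L * K)) / 2" by metis
  \<comment> \<open>One step along the chain multiplies \<open>S\<close> by L^2, so the differences
    form a chain of the same type.\<close>
  define g where "g j x = f j x + - (B * L ^ (2 * j)) * S x" for j x
  define G where "G = M + L ^ (2 * n) * (B * exp (L * K))"
  have "\<bar>g 0 x\<bar> \<le> K ^ n * G / fact (2 * n)"
  proof (rule alternating_chain_remainder[where g=g and y=y and v="\<lambda>j x. f' j x + - (B * L ^ (2 * j)) * V x"])
    show "string_equation \<rho> (g j) (\<lambda>x. f' j x + - (B * L ^ (2 * j)) * V x) (g (Suc j))" if "j < n" for j
      using string_equation_add[OF eq[OF that] string_equation_cmult[OF S, of "- (B * L ^ (2 * j))"]]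
      by (simp add: g_def[abs_def] power2_eq_square mult_ac)
    show "continuous_on {0..1} (g n)" "continuous_on {0..1} (g 0)"
      unfolding g_def[abs_def] using fn f0 string_equation_continuous[OF S] by (auto intro!: continuous_intros)
    show "y i \<in> {0..1} \<and> (-1) ^ i * g 0 (y i) < 0" if i: "i \<le> 2 * n + 1" for i
    proof
      show "y i \<in> {0..1}" using y(1)[OF i] pr[OF i] ab by auto
      have "B * (exp (- (L * K)) / 2) \<le> B * ((-1) ^ i * S (y i))"
        using S_ge[OF i y(1)[OF i]] B by (intro mult_left_mono) auto
      moreover have "(-1) ^ i * f 0 (y i) \<le> \<bar>f 0 (y i)\<bar>"
        by (cases "even i") auto
      ultimately have "(-1) ^ i * f 0 (y i) < B * ((-1) ^ i * S (y i))" using y(2)[OF i] by simp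
      then show "(-1) ^ i * g 0 (y i) < 0" by (simp add: g_def algebra_simps)
    qed
    show "y i < y (Suc i)" if "i \<le> 2 * n" for i
      using y(1)[of i] y(1)[of "Suc i"] rp[of i] that by auto
    show "\<bar>g n x\<bar> \<le> G" if "x \<in> {0..1}" for x
    proof -
      have "\<bar>g n x\<bar> \<le> \<bar>f n x\<bar> + \<bar>- (B * L ^ (2 * n)) * S x\<bar>" unfolding g_def by (rule abs_triangle_ineq)
      also have "\<bar>- (B * L ^ (2 * n)) * S x\<bar> = L ^ (2 * n) * (B * \<bar>S x\<bar>)"
        using B L by (simp add: abs_mult)
      also have "\<bar>f n x\<bar> + L ^ (2 * n) * (B * \<bar>S x\<bar>) \<le> G"
        unfolding G_def using M[OF that] S_bd[OF that] B L by (intro add_mono mult_left_mono) auto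
      finally show ?thesis .
    qed
    show "x \<in> {y (2 * n + 1)..1}" using x y(1)[of "2 * n + 1"] pr[of "2 * n + 1"] by auto
  qed
  also have "K ^ n * G / fact (2 * n) = K ^ n * M / fact (2 * n) + (K ^ n * L ^ (2 * n) / fact (2 * n)) * (B * exp (L * K))"
    by (simp add: G_def algebra_simps add_divide_distrib)
  \<comment> \<open>After K^n is replaced by K^(2n), this is a single term of the series of
    e^(LK).\<close>
  also have "K ^ n * L ^ (2 * n) / fact (2 * n) \<le> exp (L * K)"
  proof -
    have "K ^ n * L ^ (2 * n) \<le> K ^ (2 * n) * L ^ (2 * n)"
      using K L by (intro mult_right_mono power_increasing) auto
    then have "K ^ n * L ^ (2 * n) / fact (2 * n) \<le> (L * K) ^ (2 * n) / fact (2 * n)"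
      by (simp add: divide_right_mono power_mult_distrib mult.commute)
    also have "\<dots> \<le> exp (L * K)"
    proof -
      have "(\<Sum>i\<in>{2 * n}. (L * K) ^ i /\<^sub>R fact i) \<le> exp (L * K)"
        unfolding exp_def using LK by (intro sum_le_suminf summable_exp_generic) auto
      then show ?thesis by (simp add: divide_inverse mult.commute)
    qed
    finally show ?thesis .
  qed
  finally have g0: "\<bar>g 0 x\<bar> \<le> K ^ n * M / fact (2 * n) + exp (L * K) * (B * exp (L * K))"
    using B by (simp add: mult_right_mono)
  have x01: "x \<in> {0..1}" using x ab by auto
  have "f 0 x = g 0 x + B * S x" by (simp add: g_def)
  then have "\<bar>f 0 x\<bar> \<le> \<bar>g 0 x\<bar> + B * \<bar>S x\<bar>"
    using B abs_triangle_ineq[of "g 0 x" "B * S x"] by (simp add: abs_mult)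
  also have "B * \<bar>S x\<bar> \<le> B * exp (2 * (L * K))"
  proof -
    have "\<bar>S x\<bar> \<le> exp (L * K)" by (rule S_bd[OF x01])
    also have "\<dots> \<le> exp (2 * (L * K))" using LK by (subst exp_le_cancel_iff) linarith
    finally show ?thesis using B by simp
  qed
  also have "\<bar>g 0 x\<bar> \<le> K ^ n * M / fact (2 * n) + B * exp (2 * (L * K))"
  proof -
    have "exp (L * K) * (B * exp (L * K)) = B * exp (2 * (L * K))"
      unfolding exp_double power2_eq_square by simp
    then show ?thesis using g0 by linarith
  qed
  finally show ?thesis by simp
qed

end

section \<open>Reflection of the unit interval and propagation to both sides\<close>

lemma has_integral_reflect_unit:
  fixes h :: "real \<Rightarrow> real"
  assumes "(h has_integral I) {a..b}"
  shows "((\<lambda>x. h (1 - x)) has_integral I) {1 - b..1 - a}"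
proof -
  have "((\<lambda>x. h (-1 * x + 1)) has_integral I) ((\<lambda>x. - x + 1) ` {a..b})"
    using has_integral_affinity[of h I a b "-1" 1] assms by simp
  moreover have "(\<lambda>x. - x + 1) ` {a..b} = {1 - b..1 - a}"
  proof (intro set_eqI iffI)
    show "x \<in> (\<lambda>x. - x + 1) ` {a..b}" if "x \<in> {1 - b..1 - a}" for x
      using that by (intro image_eqI[of _ _ "1 - x"]) auto
  qed auto
  moreover have "(\<lambda>x. h (-1 * x + 1)) = (\<lambda>x. h (1 - x))" by (simp add: fun_eq_iff algebra_simps)
  ultimately show ?thesis by simp
qed

lemma lipschitz_primitive_reflect:
  assumes "lipschitz_primitive 0 1 F f"
  shows "lipschitz_primitive 0 1 (\<lambda>x. F (1 - x)) (\<lambda>x. - f (1 - x))"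
proof -
  obtain C Z where C: "C-lipschitz_on {0..1} F" and Z: "negligible Z"
    and der: "\<And>x. x \<in> {0..1} - Z \<Longrightarrow> (F has_real_derivative f x) (at x within {0..1})"
    using lipschitz_primitiveE[OF assms] by metis
  show ?thesis
  proof (rule lipschitz_primitiveI)
    show "C-lipschitz_on {0..1} (\<lambda>x. F (1 - x))"
    proof (rule lipschitz_onI)
      fix x y :: real assume "x \<in> {0..1}" "y \<in> {0..1}"
      then have "dist (F (1 - x)) (F (1 - y)) \<le> C * dist (1 - x) (1 - y)"
        by (intro lipschitz_onD[OF C]) auto
      then show "dist (F (1 - x)) (F (1 - y)) \<le> C * dist x y"
        by (simp add: dist_real_def abs_minus_commute)
    qed (use C lipschitz_on_nonneg in blast)
    show "negligible ((\<lambda>x. 1 - x) ` Z)"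
      using Z by (auto intro!: negligible_differentiable_image_negligible derivative_intros simp: differentiable_on_def)
    fix x assume x: "x \<in> {0..1} - (\<lambda>x. 1 - x) ` Z"
    have "1 - x \<in> {0..1} - Z" using x by (auto intro: image_eqI[of _ _ "1 - x"])
    then have "(F has_real_derivative f (1 - x)) (at (1 - x) within (\<lambda>x. 1 - x) ` {0..1})"
      by (intro DERIV_subset[OF der]) auto
    moreover have "((\<lambda>x. 1 - x) has_real_derivative -1) (at x within {0..1})"
      by (auto intro!: derivative_eq_intros)
    ultimately have "((F \<circ> (\<lambda>x. 1 - x)) has_real_derivative f (1 - x) * -1) (at x within {0..1})"
      by (rule DERIV_image_chain)
    then show "((\<lambda>x. F (1 - x)) has_real_derivative - f (1 - x)) (at x within {0..1})"
      by (simp add: o_def)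
  qed
qed

lemma string_equation_reflect:
  assumes "string_equation \<rho> u v w"
  shows "string_equation (\<lambda>x. \<rho> (1 - x)) (\<lambda>x. u (1 - x)) (\<lambda>x. - v (1 - x)) (\<lambda>x. w (1 - x))"
proof -
  have v: "lipschitz_primitive 0 1 v (\<lambda>x. - (\<rho> x * w x))"
    using assms by (simp add: string_equation_def)
  have "lipschitz_primitive 0 1 (\<lambda>x. - v (1 - x)) (\<lambda>x. - (\<rho> (1 - x) * w (1 - x)))"
    using lipschitz_primitive_cmult[OF lipschitz_primitive_reflect[OF v], of "-1"] by simp
  moreover have "lipschitz_primitive 0 1 (\<lambda>x. u (1 - x)) (\<lambda>x. - v (1 - x))"
    by (rule lipschitz_primitive_reflect[OF string_equation_lipschitz_primitive[OF assms]])
  ultimately show ?thesis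
    using lipschitz_primitive_continuous_deriv lipschitz_primitive_continuous_on
    unfolding string_equation_def by blast
qed

context bounded_density
begin

text \<open>Measurability of the reflected density is read off from its integrability, which the
  change of variables supplies.\<close>

lemma reflect: "bounded_density (\<lambda>x. \<rho> (1 - x)) K"
proof
  have "\<rho> integrable_on {0..1}" using integrable_mult[of "\<lambda>_. 1"] by simp
  then have "((\<lambda>x. \<rho> (1 - x)) has_integral integral {0..1} \<rho>) {0..1}"
    using has_integral_reflect_unit[of \<rho> _ 0 1] by auto
  then show "(\<lambda>x. \<rho> (1 - x)) \<in> borel_measurable (lebesgue_on {0..1})"
    by (intro integrable_imp_measurable) blast
qed (use K lower upper in auto)

text \<open>The interval is cut at its centre \<xi>. Points to the right of \<xi> are reached from
  the left half, the others from the right half after reflection, so points inside the interval are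
  covered as well. Hence the oscillation condition involves the half-length
  \<open>h\<close>.\<close>

lemma propagation:
  assumes eq: "\<And>j. j < n \<Longrightarrow> string_equation \<rho> (f j) (f' j) (f (Suc j))"
    and fn: "continuous_on {0..1} (f n)" and f0: "continuous_on {0..1} (f 0)"
    and M: "\<And>x. x \<in> {0..1} \<Longrightarrow> \<bar>f n x\<bar> \<le> M"
    and h: "0 < h" "0 \<le> \<xi> - h" "\<xi> + h \<le> 1"
    and L: "L > 0" "K * ((2 * real n + 3) * pi) \<le> L * h"
    and B: "B > 0" "exp (4 * (L * K)) * integral {\<xi> - h..\<xi> + h} (\<lambda>x. (f 0 x)\<^sup>2) < B\<^sup>2"
    and x: "x \<in> {0..1}"
  shows "\<bar>f 0 x\<bar> \<le> 2 * B * exp (2 * (L * K)) + K ^ n * M / fact (2 * n)"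
proof -
  have sq_int: "(\<lambda>x. (f 0 x)\<^sup>2) integrable_on {c..d}" if "{c..d} \<subseteq> {0..1}" for c d
    by (intro integrable_continuous_real continuous_intros continuous_on_subset[OF f0 that])
  have sub_int: "exp (4 * (L * K)) * integral {c..d} (\<lambda>x. (f 0 x)\<^sup>2) < B\<^sup>2" if "{c..d} \<subseteq> {\<xi> - h..\<xi> + h}" for c d
  proof -
    have "integral {c..d} (\<lambda>x. (f 0 x)\<^sup>2) \<le> integral {\<xi> - h..\<xi> + h} (\<lambda>x. (f 0 x)\<^sup>2)"
      using that h by (intro integral_subset_le sq_int) auto
    then have "exp (4 * (L * K)) * integral {c..d} (\<lambda>x. (f 0 x)\<^sup>2)
        \<le> exp (4 * (L * K)) * integral {\<xi> - h..\<xi> + h} (\<lambda>x. (f 0 x)\<^sup>2)"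
      by (intro mult_left_mono) auto
    then show ?thesis using B(2) by linarith
  qed
  show ?thesis
  proof (cases "\<xi> \<le> x")
    case True
    show ?thesis
    proof (rule right_propagation[OF eq fn f0 M, of "\<xi> - h" \<xi> L B x])
      show "exp (4 * (L * K)) * integral {\<xi> - h..\<xi>} (\<lambda>x. (f 0 x)\<^sup>2) < B\<^sup>2"
        using h by (intro sub_int) auto
    qed (use h L B x True in auto)
  next
    case False
    interpret R: bounded_density "\<lambda>x. \<rho> (1 - x)" K by (rule reflect)
    have cont: "continuous_on {0..1} (\<lambda>x. f j (1 - x))" if "continuous_on {0..1} (f j)" for j
      by (rule continuous_on_compose2[OF that]) (auto intro!: continuous_intros)
    have "\<bar>(\<lambda>j x. f j (1 - x)) 0 (1 - x)\<bar> \<le> 2 * B * exp (2 * (L * K)) + K ^ n * M / fact (2 * n)"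
    proof (rule R.right_propagation[where f="\<lambda>j x. f j (1 - x)" and \<alpha>="1 - \<xi> - h" and \<beta>="1 - \<xi>"
          and f'="\<lambda>j x. - f' j (1 - x)"])
      show "string_equation (\<lambda>x. \<rho> (1 - x)) (\<lambda>x. f j (1 - x)) (\<lambda>x. - f' j (1 - x)) (\<lambda>x. f (Suc j) (1 - x))"
        if "j < n" for j
        by (rule string_equation_reflect[OF eq[OF that]])
      have "((\<lambda>x. (f 0 (1 - x))\<^sup>2) has_integral integral {\<xi>..\<xi> + h} (\<lambda>x. (f 0 x)\<^sup>2)) {1 - (\<xi> + h)..1 - \<xi>}"
        by (rule has_integral_reflect_unit[OF integrable_integral[OF sq_int]]) (use h in auto)
      then have "integral {1 - \<xi> - h..1 - \<xi>} (\<lambda>x. (f 0 (1 - x))\<^sup>2) = integral {\<xi>..\<xi> + h} (\<lambda>x. (f 0 x)\<^sup>2)"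
        by (simp add: integral_unique diff_diff_eq)
      then show "exp (4 * (L * K)) * integral {1 - \<xi> - h..1 - \<xi>} (\<lambda>x. (f 0 (1 - x))\<^sup>2) < B\<^sup>2"
        using sub_int[of \<xi> "\<xi> + h"] h by simp
    qed (use h L B x M False cont[OF fn] cont[OF f0] in auto)
    then show ?thesis by simp
  qed
qed

end

section \<open>The spectral inequality\<close>

lemma AE_lebesgue_on_negligible:
  assumes "AE x in lebesgue_on S. P x" "S \<in> sets lebesgue"
  obtains N where "negligible N" "\<And>x. x \<in> S - N \<Longrightarrow> P x"
proof -
  have "AE x in lebesgue. x \<in> S \<longrightarrow> P x"
    using assms by (simp add: AE_restrict_space_iff)
  then show ?thesis
    using that unfolding eventually_ae_filter_negligible by blast
qed

text \<open>Applied to two Gram matrices: that of the eigenfunctions with weight \<rho> and that of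
  their derivatives.\<close>

lemma has_integral_quadratic_form_diagonal:
  fixes \<phi> :: "'i \<Rightarrow> 'i \<Rightarrow> 'a::euclidean_space \<Rightarrow> real"
  assumes S: "finite S"
    and \<phi>: "\<And>j k. j \<in> S \<Longrightarrow> k \<in> S \<Longrightarrow> (\<phi> j k has_integral (if j = k then c k else 0)) A"
  shows "((\<lambda>x. \<Sum>j\<in>S. \<Sum>k\<in>S. b j * b k * \<phi> j k x) has_integral (\<Sum>k\<in>S. (b k)\<^sup>2 * c k)) A"
proof -
  have "((\<lambda>x. \<Sum>j\<in>S. \<Sum>k\<in>S. b j * b k * \<phi> j k x) has_integral
      (\<Sum>j\<in>S. \<Sum>k\<in>S. b j * b k * (if j = k then c k else 0))) A"
    using S \<phi> by (intro has_integral_sum has_integral_mult_right)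
  moreover have "(\<Sum>j\<in>S. \<Sum>k\<in>S. b j * b k * (if j = k then c k else 0)) = (\<Sum>k\<in>S. (b k)\<^sup>2 * c k)"
    using S by (intro sum.cong refl) (simp add: if_distrib[of "\<lambda>t. _ * t"] power2_eq_square cong: if_cong)
  ultimately show ?thesis by simp
qed

text \<open>Cauchy-Schwarz by completing the square: integrating (V - F x)^2 \<ge> 0 over
  \<open>{0..x}\<close>, where \<open>V\<close> has integral \<open>F x\<close>, shows that (2 - x)
  (F x)^2 is at most the integral of V^2.\<close>

lemma square_le_integral_deriv_square:
  fixes F V :: "real \<Rightarrow> real"
  assumes F: "lipschitz_primitive 0 1 F V" and "F 0 = 0" and V: "continuous_on {0..1} V" and x: "x \<in> {0..1}"
  shows "(F x)\<^sup>2 \<le> integral {0..1} (\<lambda>t. (V t)\<^sup>2)"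
proof -
  have sub: "{0..x} \<subseteq> {0..1}" using x by auto
  have V2: "(\<lambda>t. (V t)\<^sup>2) integrable_on {c..d}" if "{c..d} \<subseteq> {0..1}" for c d
    by (intro integrable_continuous_real continuous_intros continuous_on_subset[OF V that])
  have "(V has_integral F x) {0..x}"
    using lipschitz_primitive_has_integral[OF F, of 0 x] x assms(2) by simp
  then have "((\<lambda>t. (V t)\<^sup>2 - 2 * F x * V t + (F x)\<^sup>2) has_integral
      integral {0..x} (\<lambda>t. (V t)\<^sup>2) - 2 * F x * F x + x * (F x)\<^sup>2) {0..x}"
    using integrable_integral[OF V2[OF sub]] has_integral_const_real[of "(F x)\<^sup>2" 0 x] x
    by (intro has_integral_add has_integral_diff has_integral_mult_right) auto
  moreover have "(V t)\<^sup>2 - 2 * F x * V t + (F x)\<^sup>2 = (V t - F x)\<^sup>2" for t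
    by (simp add: power2_eq_square algebra_simps)
  ultimately have "((\<lambda>t. (V t - F x)\<^sup>2) has_integral
      integral {0..x} (\<lambda>t. (V t)\<^sup>2) - 2 * F x * F x + x * (F x)\<^sup>2) {0..x}" by simp
  then have "0 \<le> integral {0..x} (\<lambda>t. (V t)\<^sup>2) - 2 * F x * F x + x * (F x)\<^sup>2"
    by (rule has_integral_nonneg) simp
  moreover have "x * (F x)\<^sup>2 \<le> (F x)\<^sup>2" using x by (simp add: mult_left_le_one_le)
  ultimately have "(F x)\<^sup>2 \<le> integral {0..x} (\<lambda>t. (V t)\<^sup>2)" by (simp add: power2_eq_square)
  also have "\<dots> \<le> integral {0..1} (\<lambda>t. (V t)\<^sup>2)"
    using sub by (intro integral_subset_le V2) auto
  finally show ?thesis .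
qed

text \<open>The exponential series at 2X instead of X gains a factor 4^n, and this absorbs 2X e^(2X)
  \<le> e^(4X) \<le> e^n because e \<le> 4.\<close>

lemma power_le_fact_half:
  assumes X: "X \<ge> 0" and n: "5 * X \<le> real n"
  shows "2 * X * X ^ (2 * n) \<le> fact (2 * n)"
proof -
  have "(\<Sum>i\<in>{2 * n}. (2 * X) ^ i /\<^sub>R fact i) \<le> exp (2 * X)"
    unfolding exp_def using X by (intro sum_le_suminf summable_exp_generic) auto
  then have *: "(2 * X) ^ (2 * n) \<le> exp (2 * X) * fact (2 * n)"
    by (simp add: divide_inverse[symmetric] field_simps)
  have "exp (1::real) ^ n \<le> 4 ^ n" using exp_le by (intro power_mono) auto
  then have "exp (real n) \<le> 4 ^ n" by (simp flip: exp_of_nat_mult)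
  have "2 * X * exp (2 * X) \<le> exp (2 * X) * exp (2 * X)"
  proof (rule mult_right_mono)
    show "2 * X \<le> exp (2 * X)" using exp_ge_add_one_self[of "2 * X"] by linarith
  qed simp
  also have "\<dots> = exp (4 * X)" by (simp flip: exp_add)
  also have "\<dots> \<le> exp (real n)" using n X by simp
  also have "\<dots> \<le> 4 ^ n" by fact
  finally have 4: "2 * X * exp (2 * X) \<le> 4 ^ n" .
  have "4 ^ n * (2 * X * X ^ (2 * n)) = 2 * X * (2 * X) ^ (2 * n)"
    by (simp add: power_mult_distrib power_mult)
  also have "\<dots> \<le> 2 * X * (exp (2 * X) * fact (2 * n))"
    using * X by (intro mult_left_mono) auto
  also have "\<dots> \<le> 4 ^ n * fact (2 * n)"
    using mult_right_mono[OF 4, of "fact (2 * n)"] by (simp add: mult_ac)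
  finally show ?thesis by simp
qed

context bounded_density
begin

text \<open>The exceptional sets of the density and of the equation are merged, together with the
  two endpoints, since the equation is given on the open interval. Boundedness of \<open>u\<close>
  and of the density bounds v', so \<open>v\<close> is Lipschitz.\<close>

lemma eigenfunction_string_equation:
  assumes ae: "AE x in lebesgue_on {0..1}. \<rho>' x = \<rho> x"
    and u: "sturm_liouville_solution \<rho>' \<Lambda> u"
  obtains v where "string_equation \<rho> u v (\<lambda>x. \<Lambda> * u x)"
proof -
  obtain v where v: "\<And>x. x \<in> {0..1} \<Longrightarrow> (u has_real_derivative v x) (at x within {0..1})"
    "abs_continuous_on {0..1} v"
    "AE x in lebesgue_on {0<..<1}. \<exists>w. (v has_real_derivative w) (at x) \<and> w + \<rho>' x * \<Lambda> * u x = 0"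
    using u unfolding sturm_liouville_solution_def by blast
  obtain N1 where N1: "negligible N1" "\<And>x. x \<in> {0..1} - N1 \<Longrightarrow> \<rho>' x = \<rho> x"
    by (rule AE_lebesgue_on_negligible[OF ae]) (auto intro: that)
  obtain N2 where N2: "negligible N2"
    "\<And>x. x \<in> {0<..<1} - N2 \<Longrightarrow> \<exists>w. (v has_real_derivative w) (at x) \<and> w + \<rho>' x * \<Lambda> * u x = 0"
    by (rule AE_lebesgue_on_negligible[OF v(3)]) (auto intro: that)
  have "continuous_on {0..1} u"
    using v(1) by (meson DERIV_continuous continuous_on_eq_continuous_within)
  then have "bounded (u ` {0..1})"
    by (simp add: compact_continuous_image compact_imp_bounded)
  then obtain U where U: "U > 0" "\<And>x. x \<in> {0..1} \<Longrightarrow> \<bar>u x\<bar> \<le> U"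
    unfolding bounded_pos by auto
  define Z where "Z = N1 \<union> N2 \<union> {0, 1}"
  have "lipschitz_primitive 0 1 v (\<lambda>x. - (\<rho> x * (\<Lambda> * u x)))"
  proof (rule lipschitz_primitive_of_abs_continuous[OF v(2)])
    show "negligible Z" using N1 N2 by (simp add: Z_def negligible_Un)
    fix x assume x: "x \<in> {0..1} - Z"
    then have "x \<in> {0<..<1} - N2" "x \<in> {0..1} - N1" by (auto simp: Z_def)
    then obtain w where w: "(v has_real_derivative w) (at x)" "w + \<rho> x * \<Lambda> * u x = 0"
      using N1(2) N2(2) by metis
    then have "w = - (\<rho> x * (\<Lambda> * u x))" by (simp add: mult.assoc)
    then show "(v has_real_derivative - (\<rho> x * (\<Lambda> * u x))) (at x within {0..1})"
      using w(1) has_field_derivative_at_within by blast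
    have "\<bar>\<rho> x\<bar> * (\<bar>\<Lambda>\<bar> * \<bar>u x\<bar>) \<le> K * (\<bar>\<Lambda>\<bar> * U)"
      using x pos[of x] upper[of x] U K by (intro mult_mono) auto
    then show "\<bar>- (\<rho> x * (\<Lambda> * u x))\<bar> \<le> K * (\<bar>\<Lambda>\<bar> * U)" by (simp add: abs_mult)
  qed (use K U in auto)
  then have "string_equation \<rho> u v (\<lambda>x. \<Lambda> * u x)"
    using v(1) by (simp add: string_equation_def)
  then show ?thesis by (rule that)
qed

text \<open>The derivative of u1 v2 integrates to zero because u1 vanishes at both ends. Only the
  second function needs to solve an eigenvalue equation, and applying the identity in both orders
  later yields orthogonality.\<close>

lemma energy_identity:
  assumes 1: "string_equation \<rho> u1 v1 w1" and 2: "string_equation \<rho> u2 v2 (\<lambda>x. \<Lambda> * u2 x)"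
    and bc: "u1 0 = 0" "u1 1 = 0"
  shows "((\<lambda>x. v1 x * v2 x) has_integral \<Lambda> * integral {0..1} (\<lambda>x. \<rho> x * (u1 x * u2 x))) {0..1}"
proof -
  have v2: "lipschitz_primitive 0 1 v2 (\<lambda>x. - (\<rho> x * (\<Lambda> * u2 x)))"
    using 2 by (simp add: string_equation_def)
  have "((\<lambda>x. v1 x * v2 x + u1 x * - (\<rho> x * (\<Lambda> * u2 x))) has_integral 0) {0..1}"
    using lipschitz_primitive_has_integral[OF lipschitz_primitive_mult[OF string_equation_lipschitz_primitive[OF 1] v2], of 0 1] bc
    by simp
  moreover have "(\<lambda>x. \<rho> x * (u1 x * u2 x)) integrable_on {0..1}"
    using string_equation_continuous[OF 1] string_equation_continuous[OF 2]
    by (intro integrable_mult continuous_intros)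
  then have "((\<lambda>x. \<Lambda> * (\<rho> x * (u1 x * u2 x))) has_integral \<Lambda> * integral {0..1} (\<lambda>x. \<rho> x * (u1 x * u2 x))) {0..1}"
    by (intro has_integral_mult_right) (rule integrable_integral)
  ultimately have "((\<lambda>x. v1 x * v2 x + u1 x * - (\<rho> x * (\<Lambda> * u2 x)) + \<Lambda> * (\<rho> x * (u1 x * u2 x))) has_integral
      0 + \<Lambda> * integral {0..1} (\<lambda>x. \<rho> x * (u1 x * u2 x))) {0..1}"
    by (rule has_integral_add)
  then show ?thesis by (simp add: mult_ac)
qed

text \<open>Propagation bounds the supremum of f by local data plus A/(2K), where A is the norm of
  the coefficients. Since A is at most K times that supremum, the remainder contributes at most A/2
  and moves to the left-hand side.\<close>

lemma spectral_inequality: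
  fixes S :: "'i set" and e v :: "'i \<Rightarrow> real \<Rightarrow> real" and l a :: "'i \<Rightarrow> real"
  assumes S: "finite S"
    and eq: "\<And>k. k \<in> S \<Longrightarrow> string_equation \<rho> (e k) (v k) (\<lambda>x. (l k)\<^sup>2 * e k x)"
    and bc: "\<And>k. k \<in> S \<Longrightarrow> e k 0 = 0 \<and> e k 1 = 0"
    and normal: "\<And>k. k \<in> S \<Longrightarrow> integral {0..1} (\<lambda>x. \<rho> x * (e k x)\<^sup>2) = 1"
    and inj: "\<And>j k. j \<in> S \<Longrightarrow> k \<in> S \<Longrightarrow> j \<noteq> k \<Longrightarrow> (l j)\<^sup>2 \<noteq> (l k)\<^sup>2"
    and l: "\<And>k. k \<in> S \<Longrightarrow> 0 < l k \<and> l k \<le> \<mu>" and \<mu>: "\<mu> \<ge> 1"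
    and h: "0 < h" "0 \<le> \<xi> - h" "\<xi> + h \<le> 1"
    and L: "L = 15 * K\<^sup>2 * \<mu> * pi / h"
  shows "(\<Sum>k\<in>S. (a k)\<^sup>2) \<le> 16 * K\<^sup>2 * exp (8 * (L * K)) *
    integral {\<xi> - h..\<xi> + h} (\<lambda>x. (\<Sum>k\<in>S. a k * e k x)\<^sup>2)"
proof -
  define ip where "ip j k = integral {0..1} (\<lambda>x. \<rho> x * (e j x * e k x))" for j k
  have vv: "((\<lambda>x. v j x * v k x) has_integral (l k)\<^sup>2 * ip j k) {0..1}" if "j \<in> S" "k \<in> S" for j k
    unfolding ip_def using energy_identity[OF eq[OF that(1)] eq[OF that(2)]] bc[OF that(1)] by simp
  have ip: "ip j k = (if j = k then 1 else 0)" if jk: "j \<in> S" "k \<in> S" for j k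
  proof (cases "j = k")
    case True
    then show ?thesis using normal[OF jk(1)] by (simp add: ip_def power2_eq_square)
  next
    case False
    \<comment> \<open>The same energy integral carries the eigenvalue of \<open>j\<close> or that of
      \<open>k\<close>, and these differ; hence the inner product is zero.\<close>
    have "ip k j = ip j k" by (simp add: ip_def mult.commute)
    then have "((\<lambda>x. v j x * v k x) has_integral (l j)\<^sup>2 * ip j k) {0..1}"
      using vv[OF jk(2,1)] by (simp add: mult.commute)
    then have "(l j)\<^sup>2 * ip j k = (l k)\<^sup>2 * ip j k" using vv[OF jk] has_integral_unique by blast
    then show ?thesis using inj[OF jk False] False by simp
  qed
  \<comment> \<open>Arbitrary coefficients are allowed because the chain consists of such sums with
    coefficients \<open>a k * l k ^ (2 * j)\<close>.\<close>
  define F where "F b x = (\<Sum>k\<in>S. b k * e k x)" for b x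
  define V where "V b x = (\<Sum>k\<in>S. b k * v k x)" for b x
  have FV: "string_equation \<rho> (F b) (V b) (F (\<lambda>k. b k * (l k)\<^sup>2))" for b
  proof -
    have "string_equation \<rho> (F b) (V b) (\<lambda>x. \<Sum>k\<in>S. b k * ((l k)\<^sup>2 * e k x))"
      unfolding F_def[abs_def] V_def[abs_def] by (intro string_equation_sum string_equation_cmult eq)
    then show ?thesis by (simp add: F_def[abs_def] mult.assoc)
  qed
  \<comment> \<open>The derivatives \<open>v k\<close> are orthogonal with squared norms equal to
    the eigenvalues, and the sum vanishes at 0, so its supremum is controlled by its energy.\<close>
  have F_bd: "(F b x)\<^sup>2 \<le> (\<Sum>k\<in>S. (b k)\<^sup>2 * (l k)\<^sup>2)" if x: "x \<in> {0..1}" for b x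
  proof -
    have "((\<lambda>x. \<Sum>j\<in>S. \<Sum>k\<in>S. b j * b k * (v j x * v k x)) has_integral (\<Sum>k\<in>S. (b k)\<^sup>2 * (l k)\<^sup>2)) {0..1}"
    proof (rule has_integral_quadratic_form_diagonal[OF S])
      show "((\<lambda>x. v j x * v k x) has_integral (if j = k then (l k)\<^sup>2 else 0)) {0..1}" if "j \<in> S" "k \<in> S" for j k
        using vv[OF that] ip[OF that] by (cases "j = k") auto
    qed
    moreover have "(\<Sum>j\<in>S. \<Sum>k\<in>S. b j * b k * (v j x * v k x)) = (V b x)\<^sup>2" for x
      by (simp add: V_def power2_eq_square sum_product mult_ac)
    ultimately have "integral {0..1} (\<lambda>x. (V b x)\<^sup>2) = (\<Sum>k\<in>S. (b k)\<^sup>2 * (l k)\<^sup>2)"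
      by (simp add: integral_unique)
    moreover have "F b 0 = 0" using bc by (simp add: F_def)
    ultimately show ?thesis
      using square_le_integral_deriv_square[OF string_equation_lipschitz_primitive[OF FV] _ string_equation_continuous_deriv[OF FV] x]
      by metis
  qed
  define A where "A = sqrt (\<Sum>k\<in>S. (a k)\<^sup>2)"
  have A: "A \<ge> 0" "A\<^sup>2 = (\<Sum>k\<in>S. (a k)\<^sup>2)" by (auto simp: A_def sum_nonneg)
  have F_norm: "((\<lambda>x. \<rho> x * (F a x)\<^sup>2) has_integral A\<^sup>2) {0..1}"
  proof -
    have "((\<lambda>x. \<Sum>j\<in>S. \<Sum>k\<in>S. a j * a k * (\<rho> x * (e j x * e k x))) has_integral (\<Sum>k\<in>S. (a k)\<^sup>2 * 1)) {0..1}"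
    proof (rule has_integral_quadratic_form_diagonal[OF S])
      fix j k assume jk: "j \<in> S" "k \<in> S"
      have "(\<lambda>x. \<rho> x * (e j x * e k x)) integrable_on {0..1}"
        using string_equation_continuous[OF eq] jk by (intro integrable_mult continuous_intros) auto
      then have "((\<lambda>x. \<rho> x * (e j x * e k x)) has_integral ip j k) {0..1}"
        unfolding ip_def by (rule integrable_integral)
      then show "((\<lambda>x. \<rho> x * (e j x * e k x)) has_integral (if j = k then 1 else 0)) {0..1}"
        using ip[OF jk] by simp
    qed
    moreover have "(\<Sum>j\<in>S. \<Sum>k\<in>S. a j * a k * (\<rho> x * (e j x * e k x))) = \<rho> x * (F a x)\<^sup>2" for x
      by (simp add: F_def power2_eq_square sum_product sum_distrib_left mult_ac)
    ultimately show ?thesis by (simp add: A)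
  qed
  define f where "f j = F (\<lambda>k. a k * (l k) ^ (2 * j))" for j
  define f' where "f' j = V (\<lambda>k. a k * (l k) ^ (2 * j))" for j
  have f_eq: "string_equation \<rho> (f j) (f' j) (f (Suc j))" for j
    using FV[of "\<lambda>k. a k * (l k) ^ (2 * j)"] by (simp add: f_def f'_def power2_eq_square mult_ac)
  have f_cont: "continuous_on {0..1} (f j)" for j by (rule string_equation_continuous[OF f_eq])
  have f0: "f 0 = F a" by (simp add: f_def)
  have f_bd: "\<bar>f j x\<bar> \<le> \<mu> ^ (2 * j + 1) * A" if x: "x \<in> {0..1}" for j x
  proof -
    have "(f j x)\<^sup>2 \<le> (\<Sum>k\<in>S. (a k * (l k) ^ (2 * j))\<^sup>2 * (l k)\<^sup>2)"
      unfolding f_def by (rule F_bd[OF x])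
    also have "\<dots> \<le> (\<Sum>k\<in>S. (\<mu> ^ (2 * j + 1))\<^sup>2 * (a k)\<^sup>2)"
    proof (rule sum_mono)
      fix k assume k: "k \<in> S"
      have "(a k * (l k) ^ (2 * j))\<^sup>2 * (l k)\<^sup>2 = ((l k) ^ (2 * j + 1))\<^sup>2 * (a k)\<^sup>2"
        by (simp add: power_mult_distrib mult_ac)
      also have "\<dots> \<le> (\<mu> ^ (2 * j + 1))\<^sup>2 * (a k)\<^sup>2"
        using l[OF k] by (intro mult_right_mono power_mono) auto
      finally show "(a k * (l k) ^ (2 * j))\<^sup>2 * (l k)\<^sup>2 \<le> (\<mu> ^ (2 * j + 1))\<^sup>2 * (a k)\<^sup>2" .
    qed
    also have "\<dots> = (\<mu> ^ (2 * j + 1) * A)\<^sup>2"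
      unfolding power_mult_distrib A(2) by (simp add: sum_distrib_left)
    finally have "\<bar>f j x\<bar> \<le> \<bar>\<mu> ^ (2 * j + 1) * A\<bar>" by (simp only: abs_le_square_iff)
    moreover have "0 \<le> \<mu> ^ (2 * j + 1) * A" using A \<mu> by (intro mult_nonneg_nonneg zero_le_power) auto
    ultimately show ?thesis by linarith
  qed
  \<comment> \<open>The threshold 5 X of the factorial estimate, for X = K \<mu>.\<close>
  define n where "n = nat \<lceil>5 * (K * \<mu>)\<rceil>"
  define X where "X = K * \<mu>"
  have X1: "X \<ge> 1" using K \<mu> mult_mono[of 1 K 1 \<mu>] by (simp add: X_def)
  have n: "5 * X \<le> real n" "real n \<le> 5 * X + 1"
    using X1 unfolding n_def X_def by linarith+
  have L_pos: "L > 0" using K \<mu> h by (simp add: L)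
  \<comment> \<open>Here 2n + 3 \<le> 10 X + 5 \<le> 15 X because X \<ge> 1; this is the origin of
    the 15 in \<open>L\<close>.\<close>
  have "(2 * real n + 3) * pi \<le> (15 * X) * pi" using n X1 by (intro mult_right_mono) auto
  then have "K * ((2 * real n + 3) * pi) \<le> K * (15 * X * pi)" using K by (intro mult_left_mono) auto
  also have "\<dots> = L * h" using h by (simp add: L X_def power2_eq_square)
  finally have L_h: "K * ((2 * real n + 3) * pi) \<le> L * h" .
  have tail: "K ^ n * (\<mu> ^ (2 * n + 1) * A) / fact (2 * n) \<le> A / (2 * K)"
  proof -
    have "2 * K * (K ^ n * \<mu> ^ (2 * n + 1)) = 2 * X * (K ^ n * \<mu> ^ (2 * n))"
      by (simp add: X_def mult_ac)
    also have "\<dots> \<le> 2 * X * (K ^ (2 * n) * \<mu> ^ (2 * n))"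
      using K \<mu> X1 by (intro mult_left_mono mult_right_mono power_increasing) auto
    also have "\<dots> = 2 * X * X ^ (2 * n)" by (simp add: X_def power_mult_distrib)
    also have "\<dots> \<le> fact (2 * n)" using X1 n by (intro power_le_fact_half) auto
    finally have "2 * K * (K ^ n * \<mu> ^ (2 * n + 1)) * A \<le> fact (2 * n) * A"
      using A by (intro mult_right_mono)
    then show ?thesis using K_pos by (simp add: field_simps)
  qed
  define E where "E = integral {\<xi> - h..\<xi> + h} (\<lambda>x. (F a x)\<^sup>2)"
  have E: "E \<ge> 0"
    unfolding E_def using h
    by (intro integral_nonneg integrable_continuous_real continuous_intros continuous_on_subset[OF f_cont[of 0, unfolded f0]]) auto
  \<comment> \<open>Propagation needs a positive \<open>B\<close> and a strict inequality, also when
    the local integral \<open>E\<close> is zero. So the bound is shown for every \<open>t\<close>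
    above e^(4LK) E, and \<open>dense_ge\<close> then passes to the limit.\<close>
  have A_le: "A\<^sup>2 \<le> 16 * K\<^sup>2 * exp (4 * (L * K)) * t" if t: "exp (4 * (L * K)) * E < t" for t
  proof -
    have t0: "t > 0" using t E by (smt (verit) exp_gt_zero mult_nonneg_nonneg)
    define B where "B = sqrt t"
    have B: "B > 0" "B\<^sup>2 = t" using t0 by (auto simp: B_def)
    define s where "s = 2 * B * exp (2 * (L * K)) + A / (2 * K)"
    have s: "s \<ge> 0" using B A K by (auto simp: s_def)
    have F_s: "\<bar>F a x\<bar> \<le> s" if x: "x \<in> {0..1}" for x
    proof -
      have "\<bar>f 0 x\<bar> \<le> 2 * B * exp (2 * (L * K)) + K ^ n * (\<mu> ^ (2 * n + 1) * A) / fact (2 * n)"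
      proof (rule propagation[where f=f and f'=f', OF f_eq f_cont f_cont f_bd h L_pos L_h B(1) _ x])
        show "exp (4 * (L * K)) * integral {\<xi> - h..\<xi> + h} (\<lambda>x. (f 0 x)\<^sup>2) < B\<^sup>2"
          using t by (simp add: f0 E_def B(2))
      qed
      then show ?thesis using tail by (simp add: s_def f0)
    qed
    have "A\<^sup>2 \<le> K * s\<^sup>2"
    proof (rule has_integral_le[OF F_norm])
      show "((\<lambda>x::real. K * s\<^sup>2) has_integral K * s\<^sup>2) {0..1}"
        using has_integral_const_real[of "K * s\<^sup>2" 0 1] by simp
      fix x :: real assume x: "x \<in> {0..1}"
      have "(F a x)\<^sup>2 \<le> s\<^sup>2" using F_s[OF x] s by (simp add: abs_le_square_iff[symmetric])
      then show "\<rho> x * (F a x)\<^sup>2 \<le> K * s\<^sup>2" using upper[OF x] K by (intro mult_mono) auto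
    qed
    also have "\<dots> \<le> K\<^sup>2 * s\<^sup>2" using K by (intro mult_right_mono) (auto simp: power2_eq_square)
    finally have "A\<^sup>2 \<le> (K * s)\<^sup>2" by (simp add: power_mult_distrib)
    then have "A \<le> K * s" by (rule power2_le_imp_le) (use s K in auto)
    also have "K * s = 2 * K * B * exp (2 * (L * K)) + A / 2" using K by (simp add: s_def field_simps)
    finally have "A \<le> 4 * K * B * exp (2 * (L * K))" by simp
    then have "A\<^sup>2 \<le> (4 * K * B * exp (2 * (L * K)))\<^sup>2" using A by (intro power_mono)
    also have "\<dots> = 16 * K\<^sup>2 * exp (4 * (L * K)) * t"
      unfolding power_mult_distrib B(2) by (simp flip: exp_double)
    finally show ?thesis .
  qed
  have "A\<^sup>2 / (16 * K\<^sup>2 * exp (4 * (L * K))) \<le> exp (4 * (L * K)) * E"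
  proof (rule dense_ge)
    fix t assume "exp (4 * (L * K)) * E < t"
    from A_le[OF this] show "A\<^sup>2 / (16 * K\<^sup>2 * exp (4 * (L * K))) \<le> t"
      using K by (simp add: divide_le_eq mult_ac)
  qed
  then have "A\<^sup>2 \<le> exp (4 * (L * K)) * E * (16 * K\<^sup>2 * exp (4 * (L * K)))"
    using K by (simp add: divide_le_eq)
  also have "\<dots> = 16 * K\<^sup>2 * (exp (4 * (L * K)) * exp (4 * (L * K))) * E" by (simp add: mult_ac)
  also have "exp (4 * (L * K)) * exp (4 * (L * K)) = exp (8 * (L * K))" by (simp flip: exp_add)
  finally show ?thesis by (simp add: A E_def F_def)
qed

end

section \<open>From a fixed interval to open sets of given inradius\<close>

lemma inradius_interval:
  assumes "inradius \<omega> = ennreal \<delta>" "0 \<le> r" "r < \<delta>"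
  obtains \<xi> where "{\<xi> - r..\<xi> + r} \<subseteq> \<omega>"
proof -
  have "ennreal r < inradius \<omega>" using assms by (simp add: ennreal_less_iff)
  then obtain s \<xi> where s: "ennreal r < ennreal s" "s > 0" "{\<xi> - s<..<\<xi> + s} \<subseteq> \<omega>"
    unfolding inradius_def less_SUP_iff by blast
  then have "r < s" using assms(2) by (simp add: ennreal_less_iff)
  then have "{\<xi> - r..\<xi> + r} \<subseteq> {\<xi> - s<..<\<xi> + s}" by auto
  then show ?thesis using s(3) by (intro that[of \<xi>]) blast
qed

lemma integral_le_lebesgue_integral_on:
  fixes g :: "real \<Rightarrow> real"
  assumes g: "continuous_on {0..1} g" and nonneg: "\<And>x. x \<in> {0..1} \<Longrightarrow> 0 \<le> g x"
    and \<omega>: "open \<omega>" "\<omega> \<subseteq> {0..1}" and sub: "{c..d} \<subseteq> \<omega>"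
  shows "integral {c..d} g \<le> (LINT x|lebesgue_on \<omega>. g x)"
proof -
  have \<omega>_sets: "\<omega> \<in> sets lebesgue" using \<omega>(1) by (simp add: borel_open)
  have "g absolutely_integrable_on \<omega>"
    by (rule set_integrable_subset[OF absolutely_integrable_continuous_real[OF g] \<omega>_sets \<omega>(2)])
  then have int: "integrable (lebesgue_on \<omega>) g"
    by (simp add: integrable_restrict_space set_integrable_def \<omega>_sets)
  then have "g integrable_on \<omega>" and eq: "(LINT x|lebesgue_on \<omega>. g x) = integral \<omega> g"
    using \<omega>_sets by (auto intro: lebesgue_integral_eq_integral integrable_on_lebesgue_on)
  moreover have "g integrable_on {c..d}"
    by (rule integrable_continuous_real[OF continuous_on_subset[OF g subset_trans[OF sub \<omega>(2)]]])
  moreover have "\<forall>x\<in>\<omega>. 0 \<le> g x" using nonneg \<omega>(2) by blast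
  ultimately show ?thesis
    unfolding eq by (intro integral_subset_le[OF sub])
qed

theorem theorem2:
  fixes K \<delta> :: real
  assumes "K \<ge> 1" and "\<delta> > 0"
  shows "\<exists>N::real. \<forall>(\<rho> :: real \<Rightarrow> real) (\<omega> :: real set) (e :: nat \<Rightarrow> real \<Rightarrow> real) (l :: nat \<Rightarrow> real).
    \<rho> \<in> borel_measurable (lebesgue_on {0..1}) \<longrightarrow>
    (AE x in lebesgue_on {0..1}. 1 / K \<le> \<rho> x \<and> \<rho> x \<le> K) \<longrightarrow>
    open \<omega> \<longrightarrow> \<omega> \<subseteq> {0<..<1} \<longrightarrow> inradius \<omega> = ennreal \<delta> \<longrightarrow>
    normalized_eigensystem \<rho> l e \<longrightarrow>
    (\<forall>(\<mu>::real) (a :: nat \<Rightarrow> real). \<mu> \<ge> 1 \<longrightarrow>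
      (\<Sum>k\<in>{k. k \<ge> 1 \<and> l k \<le> \<mu>}. (a k)\<^sup>2)
        \<le> N * exp (N * \<mu>) *
          (LINT x|lebesgue_on \<omega>. \<bar>\<Sum>k\<in>{k. k \<ge> 1 \<and> l k \<le> \<mu>}. a k * e k x\<bar>\<^sup>2))"
proof -
  \<comment> \<open>The first entry dominates the prefactor of the spectral inequality, the second
    its exponent divided by \<mu>: 8 L K with half-length \<delta>/2 has the coefficient 8 * 15 * 2
    = 240.\<close>
  define N where "N = max (16 * K\<^sup>2) (240 * K ^ 3 * pi / \<delta>)"
  show ?thesis
  proof (intro exI[of _ N] allI impI)
    fix \<rho>' :: "real \<Rightarrow> real" and \<omega> :: "real set" and e :: "nat \<Rightarrow> real \<Rightarrow> real" and l :: "nat \<Rightarrow> real"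
      and \<mu> :: real and a :: "nat \<Rightarrow> real"
    assume meas: "\<rho>' \<in> borel_measurable (lebesgue_on {0..1})"
      and ae: "AE x in lebesgue_on {0..1}. 1 / K \<le> \<rho>' x \<and> \<rho>' x \<le> K"
      and \<omega>: "open \<omega>" "\<omega> \<subseteq> {0<..<1}" and inr: "inradius \<omega> = ennreal \<delta>"
      and sys: "normalized_eigensystem \<rho>' l e" and \<mu>: "\<mu> \<ge> 1"
    let ?S = "{k. k \<ge> 1 \<and> l k \<le> \<mu>}"
    let ?f = "\<lambda>x. \<Sum>k\<in>?S. a k * e k x"
    show "(\<Sum>k\<in>?S. (a k)\<^sup>2) \<le> N * exp (N * \<mu>) * (LINT x|lebesgue_on \<omega>. \<bar>?f x\<bar>\<^sup>2)"
    proof (cases "finite ?S")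
      case False
      \<comment> \<open>a sum over an infinite index set is 0\<close>
      then show ?thesis by simp
    next
      case S: True
      \<comment> \<open>Truncation changes the given density only on a null set, so the
        eigenfunctions and their normalization carry over to a density that is bounded at every
        point.\<close>
      define \<rho> where "\<rho> x = max (1 / K) (min K (\<rho>' x))" for x
      have K1: "1 / K \<le> K" using assms(1) by (simp add: divide_le_eq mult_ge1_I)
      interpret bounded_density \<rho> K
      proof
        show "\<rho> \<in> borel_measurable (lebesgue_on {0..1})"
          unfolding \<rho>_def[abs_def] using meas by measurable
      qed (use assms K1 in \<open>auto simp: \<rho>_def\<close>)
      have ae_eq: "AE x in lebesgue_on {0..1}. \<rho>' x = \<rho> x"
        using ae by eventually_elim (auto simp: \<rho>_def)
      have eig: "dirichlet_eigenfunction \<rho>' ((l k)\<^sup>2) (e k)"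
          "(LINT x|lebesgue_on {0..1}. \<rho>' x * (e k x)\<^sup>2) = 1" "l k > 0" if "k \<ge> 1" for k
        using sys that unfolding normalized_eigensystem_def by blast+
      have "\<exists>v. string_equation \<rho> (e k) v (\<lambda>x. (l k)\<^sup>2 * e k x)" if "k \<ge> 1" for k
        using eigenfunction_string_equation[OF ae_eq, of "(l k)\<^sup>2" "e k"] eig(1)[OF that]
        unfolding dirichlet_eigenfunction_def by blast
      then obtain v where v: "\<And>k. k \<ge> 1 \<Longrightarrow> string_equation \<rho> (e k) (v k) (\<lambda>x. (l k)\<^sup>2 * e k x)"
        by metis
      note e_cont = string_equation_continuous[OF v]
      \<comment> \<open>Two changes at once: from the given density to the truncated one, and from
        the Lebesgue integral to the gauge integral.\<close>
      have normal: "integral {0..1} (\<lambda>x. \<rho> x * (e k x)\<^sup>2) = 1" if k: "k \<ge> 1" for k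
      proof -
        have e2: "continuous_on {0..1} (\<lambda>x. (e k x)\<^sup>2)" using e_cont[OF k] by (intro continuous_intros)
        have e2_meas: "(\<lambda>x. (e k x)\<^sup>2) \<in> borel_measurable (lebesgue_on {0..1})"
          by (rule continuous_imp_measurable_on_sets_lebesgue[OF e2]) simp
        have "integrable (lebesgue_on {0..1}) (\<lambda>x. \<rho> x * (e k x)\<^sup>2)"
          using absolutely_integrable_mult[OF e2] by (simp add: integrable_restrict_space set_integrable_def)
        then have "integral {0..1} (\<lambda>x. \<rho> x * (e k x)\<^sup>2) = (LINT x|lebesgue_on {0..1}. \<rho> x * (e k x)\<^sup>2)"
          by (simp add: lebesgue_integral_eq_integral)
        also have "\<dots> = (LINT x|lebesgue_on {0..1}. \<rho>' x * (e k x)\<^sup>2)"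
        proof (rule integral_cong_AE)
          show "AE x in lebesgue_on {0..1}. \<rho> x * (e k x)\<^sup>2 = \<rho>' x * (e k x)\<^sup>2"
            using ae_eq by eventually_elim simp
        qed (use meas measurable e2_meas in auto)
        finally show ?thesis using eig(2)[OF k] by simp
      qed
      have inj: "(l j)\<^sup>2 \<noteq> (l k)\<^sup>2" if "j \<ge> 1" "k \<ge> 1" "j \<noteq> k" for j k
        using sys that strict_mono_on_imp_inj_on[of "{1..}" "\<lambda>k. (l k)\<^sup>2"]
        unfolding normalized_eigensystem_def inj_on_def by auto
      obtain \<xi> where \<xi>: "{\<xi> - \<delta> / 2..\<xi> + \<delta> / 2} \<subseteq> \<omega>"
        using inradius_interval[OF inr, of "\<delta> / 2"] assms(2) by auto
      have "{\<xi> - \<delta> / 2, \<xi> + \<delta> / 2} \<subseteq> \<omega>" using \<xi> assms(2) by auto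
      then have h: "0 < \<delta> / 2" "0 \<le> \<xi> - \<delta> / 2" "\<xi> + \<delta> / 2 \<le> 1" using \<omega>(2) assms(2) by auto
      define L where "L = 15 * K\<^sup>2 * \<mu> * pi / (\<delta> / 2)"
      define I where "I = (LINT x|lebesgue_on \<omega>. (?f x)\<^sup>2)"
      have f_cont: "continuous_on {0..1} ?f"
        using e_cont by (intro continuous_intros) auto
      have "(\<Sum>k\<in>?S. (a k)\<^sup>2) \<le> 16 * K\<^sup>2 * exp (8 * (L * K)) *
          integral {\<xi> - \<delta> / 2..\<xi> + \<delta> / 2} (\<lambda>x. (?f x)\<^sup>2)"
      proof (rule spectral_inequality[OF S _ _ _ _ _ \<mu> h L_def])
        show "string_equation \<rho> (e k) (v k) (\<lambda>x. (l k)\<^sup>2 * e k x)" if "k \<in> ?S" for k using v that by simp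
        show "e k 0 = 0 \<and> e k 1 = 0" if "k \<in> ?S" for k
          using eig(1) that by (simp add: dirichlet_eigenfunction_def)
        show "integral {0..1} (\<lambda>x. \<rho> x * (e k x)\<^sup>2) = 1" if "k \<in> ?S" for k using normal that by simp
        show "(l j)\<^sup>2 \<noteq> (l k)\<^sup>2" if "j \<in> ?S" "k \<in> ?S" "j \<noteq> k" for j k using inj that by simp
        show "0 < l k \<and> l k \<le> \<mu>" if "k \<in> ?S" for k using eig(3) that by simp
      qed
      also have "\<dots> \<le> 16 * K\<^sup>2 * exp (8 * (L * K)) * I"
        unfolding I_def using \<omega> \<xi>
        by (intro mult_left_mono integral_le_lebesgue_integral_on continuous_on_power[OF f_cont]) auto
      also have "\<dots> \<le> N * exp (N * \<mu>) * I"
      proof (intro mult_right_mono mult_mono)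
        show "0 \<le> I" unfolding I_def by simp
        have "8 * (L * K) = 240 * K ^ 3 * pi / \<delta> * \<mu>"
          by (simp add: L_def power2_eq_square power3_eq_cube)
        also have "\<dots> \<le> N * \<mu>" using \<mu> by (intro mult_right_mono) (auto simp: N_def)
        finally show "exp (8 * (L * K)) \<le> exp (N * \<mu>)" by simp
        show "16 * K\<^sup>2 \<le> N" by (simp add: N_def)
        have "0 \<le> 16 * K\<^sup>2" by simp
        also have "\<dots> \<le> N" by (simp add: N_def)
        finally show "0 \<le> N" .
      qed simp
      finally show ?thesis by (simp add: I_def)
    qed
  qed
qed

end
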